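(* Let $p,q\geq 0$ with $m=p+q$, consider $\mathrm{PO}(p,q)<\mathrm{PGL}_m\mathbb{R}$, and let $\mathrm{O}'$ be the conjugacy limit of $\mathrm{PO}(p,q)$ via a sequence $[b_n]\in\mathrm{PGL}_m\mathbb{R}$ as $n\to\infty$. Then the Lie algebra $\mathfrak{o}'$ of $\mathrm{O}'$ is isomorphic to the Lie algebra obtained from $\mathfrak{po}(p,q)$ by a composition of finitely many contractions, i.e. there are Lie algebras $\mathfrak{h}_0=\mathfrak{po}(p,q),\mathfrak{h}_1,\dots,\mathfrak{h}_s$ such that each $\mathfrak{h}_{l+1}$ is the contraction of $\mathfrak{h}_l$ along some Lie subalgebra $\mathfrak{t}_l\subset\mathfrak{h}_l$, and $\mathfrak{h}_s\cong\mathfrak{o}'$.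
   Context: $\mathrm{O}(p,q)$ is the group of real $m\times m$ matrices preserving the quadratic form $-x_1^2-\dots-x_p^2+x_{p+1}^2+\dots+x_{p+q}^2$; $\mathrm{PO}(p,q)$ is its image in $\mathrm{PGL}_m\mathbb{R}$ (matrices modulo nonzero scalars). The Lie algebra $\mathfrak{pgl}_m\mathbb{R}$ consists of real $m\times m$ matrices modulo real multiples of the identity (identified with $\mathfrak{sl}_m\mathbb{R}$ via trace-zero representatives); $\mathfrak{po}(p,q)$ is the Lie algebra of $\mathrm{PO}(p,q)$. A sequence of closed subgroups $H_n<\mathrm{PGL}_m\mathbb{R}$ converges geometrically to a closed subgroup $L$ if every element of $L$ is the limit of some sequence $h_n\in H_n$ and every accumulation point of every sequence $h_n\in H_n$ lies in $L$; the conjugacy limit of $H$ via $[b_n]$ is the geometric limit of $[b_n]H[b_n]^{-1}$. Contraction: for a Lie algebra $\mathfrak{h}$ with bracket $[\cdot,\cdot]$, a Lie subalgebra $\mathfrak{t}$ and a complementary vector subspace $\mathfrak{t}^c$ (so every $X$ is uniquely $X_{\mathfrak{t}}+X_{\mathfrak{t}^c}$), set $\phi_\varepsilon(X)=X_{\mathfrak{t}}+\varepsilon X_{\mathfrak{t}^c}$ for $\varepsilon>0$; the contraction of $\mathfrak{h}$ along $\mathfrak{t}$ is the underlying vector space of $\mathfrak{h}$ with the bracket $[X,Y]'=\lim_{\varepsilon\to0}\phi_\varepsilon^{-1}([\phi_\varepsilon(X),\phi_\varepsilon(Y)])$. *)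

theory Defs
  imports "HOL-Analysis.Analysis"
begin

type_synonym 'm mtx = "real^'m^'m"

primrec mpow :: "'m::finite mtx \<Rightarrow> nat \<Rightarrow> 'm mtx" where
  "mpow A 0 = mat 1"
| "mpow A (Suc k) = A ** mpow A k"

definition mexp :: "'m::finite mtx \<Rightarrow> 'm mtx" where
  "mexp A = (\<Sum>k. (1 / fact k) *\<^sub>R mpow A k)"

text \<open>A subset of PGL_m R is encoded as a set of invertible matrices that is
  closed under multiplication by nonzero scalars (its full preimage).\<close>
definition pgl_set :: "'m::finite mtx set \<Rightarrow> bool" where
  "pgl_set S \<longleftrightarrow> (\<forall>g\<in>S. invertible g) \<and> (\<forall>g\<in>S. \<forall>c. c \<noteq> 0 \<longrightarrow> c *\<^sub>R g \<in> S)"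

text \<open>Convergence in PGL_m R (quotient topology): the classes of h n converge to
  the class of g iff suitable rescaled representatives converge to g.\<close>
definition pgl_tendsto :: "(nat \<Rightarrow> 'm::finite mtx) \<Rightarrow> 'm mtx \<Rightarrow> bool" where
  "pgl_tendsto h g \<longleftrightarrow>
     (\<exists>c::nat \<Rightarrow> real. (\<forall>n. c n \<noteq> 0) \<and> (\<lambda>n. c n *\<^sub>R h n) \<longlonglongrightarrow> g)"

text \<open>Geometric convergence of subgroups H n to L (all given by preimages).\<close>
definition geom_converges :: "(nat \<Rightarrow> 'm::finite mtx set) \<Rightarrow> 'm mtx set \<Rightarrow> bool" where
  "geom_converges H L \<longleftrightarrow>
     (\<forall>g\<in>L. \<exists>h. (\<forall>n. h n \<in> H n) \<and> pgl_tendsto h g) \<and>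
     (\<forall>h g r. (\<forall>n. h n \<in> H n) \<and> strict_mono r \<and> invertible g \<and> pgl_tendsto (h \<circ> r) g
              \<longrightarrow> g \<in> L)"

definition conj_set :: "'m::finite mtx \<Rightarrow> 'm mtx set \<Rightarrow> 'm mtx set" where
  "conj_set b H = {b ** h ** matrix_inv b | h. h \<in> H}"

definition form_mat :: "'m::finite set \<Rightarrow> 'm mtx" where
  "form_mat P = (\<chi> i j. if i = j then (if i \<in> P then -1 else 1) else 0)"

definition O_pq :: "'m::finite set \<Rightarrow> 'm mtx set" where
  "O_pq P = {g. transpose g ** form_mat P ** g = form_mat P}"

text \<open>Preimage in GL_m R of PO(p,q) = image of O(p,q) in PGL_m R.\<close>
definition PO_pq :: "'m::finite set \<Rightarrow> 'm mtx set" where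
  "PO_pq P = {c *\<^sub>R g | c g. c \<noteq> 0 \<and> g \<in> O_pq P}"

text \<open>Lie algebra of a closed subgroup of PGL_m R (given by its preimage H),
  as a subset of pgl_m R identified with the trace-zero matrices sl_m R:
  the X with exp(tX) in H for all real t.\<close>
definition lie_pgl :: "'m::finite mtx set \<Rightarrow> 'm mtx set" where
  "lie_pgl H = {X. trace X = 0 \<and> (\<forall>t::real. mexp (t *\<^sub>R X) \<in> H)}"

definition commutator :: "'m::finite mtx \<Rightarrow> 'm mtx \<Rightarrow> 'm mtx" where
  "commutator X Y = X ** Y - Y ** X"

text \<open>A Lie algebra structure is a bracket on a (real) subspace V of the matrices.
  All algebras in a chain of contractions share the underlying vector space V.\<close>

definition lie_subalgebra :: "'a::real_vector set \<Rightarrow> ('a \<Rightarrow> 'a \<Rightarrow> 'a) \<Rightarrow> 'a set \<Rightarrow> bool" where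
  "lie_subalgebra V B T \<longleftrightarrow> subspace T \<and> T \<subseteq> V \<and> (\<forall>X\<in>T. \<forall>Y\<in>T. B X Y \<in> T)"

definition complementary :: "'a::real_vector set \<Rightarrow> 'a set \<Rightarrow> 'a set \<Rightarrow> bool" where
  "complementary V T Tc \<longleftrightarrow> subspace T \<and> subspace Tc \<and> T \<subseteq> V \<and> Tc \<subseteq> V \<and>
     (\<forall>X\<in>V. \<exists>!p. fst p \<in> T \<and> snd p \<in> Tc \<and> X = fst p + snd p)"

definition proj_T :: "'a::real_vector set \<Rightarrow> 'a set \<Rightarrow> 'a \<Rightarrow> 'a" where
  "proj_T T Tc X = (THE a. a \<in> T \<and> X - a \<in> Tc)"

definition phi_contr :: "'a::real_vector set \<Rightarrow> 'a set \<Rightarrow> real \<Rightarrow> 'a \<Rightarrow> 'a" where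
  "phi_contr T Tc \<epsilon> X = proj_T T Tc X + \<epsilon> *\<^sub>R (X - proj_T T Tc X)"

definition is_contraction ::
  "'a::real_normed_vector set \<Rightarrow> ('a \<Rightarrow> 'a \<Rightarrow> 'a) \<Rightarrow> 'a set \<Rightarrow> 'a set \<Rightarrow> ('a \<Rightarrow> 'a \<Rightarrow> 'a) \<Rightarrow> bool" where
  "is_contraction V B T Tc B' \<longleftrightarrow>
     lie_subalgebra V B T \<and> complementary V T Tc \<and>
     (\<forall>X\<in>V. \<forall>Y\<in>V.
        ((\<lambda>\<epsilon>. inv_into V (phi_contr T Tc \<epsilon>)
                 (B (phi_contr T Tc \<epsilon> X) (phi_contr T Tc \<epsilon> Y))) \<longlongrightarrow> B' X Y) (at_right 0))"

definition lie_iso ::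
  "'a::real_vector set \<Rightarrow> ('a \<Rightarrow> 'a \<Rightarrow> 'a) \<Rightarrow> 'b::real_vector set \<Rightarrow> ('b \<Rightarrow> 'b \<Rightarrow> 'b) \<Rightarrow> bool" where
  "lie_iso V B W C \<longleftrightarrow>
     (\<exists>f. bij_betw f V W \<and>
          (\<forall>X\<in>V. \<forall>Y\<in>V. f (X + Y) = f X + f Y) \<and>
          (\<forall>X\<in>V. \<forall>c. f (c *\<^sub>R X) = c *\<^sub>R f X) \<and>
          (\<forall>X\<in>V. \<forall>Y\<in>V. f (B X Y) = C (f X) (f Y)))"

end

theory Submission
  imports Defs
begin

text \<open>Minimising weighted column norms of \<open>b\<^sub>n h\<close> over O(p,q) yields a decomposition
  \<open>b\<^sub>n = k\<^sub>n a\<^sub>n h\<^sub>n\<close> with \<open>k\<^sub>n\<close> orthogonal, \<open>a\<^sub>n\<close> positive diagonal and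
  \<open>h\<^sub>n\<close> in O(p,q). After passing to a subsequence, \<open>k\<^sub>n\<close> converges and the ratios of the entries of
  \<open>a\<^sub>n\<close> sort the indices into levels, the ratio between two indices tending to \<open>0\<close> or to a positive
  constant according to whether their levels differ. Conjugation by \<open>a\<^sub>n\<close> then degenerates so(p,q) to the block
  triangular matrices whose diagonal blocks are orthogonal for the restricted forms. That the limit group has no larger
  Lie algebra follows because the inverse of an element of the conjugated group is, up to a scalar, its transpose with
  entries rescaled by squared ratios, a relation which passes to the limit and can be differentiated at the identity.
  The same Lie algebra arises from so(p,q) by contracting, for each cut of the levels in two, along the matrices
  that are block diagonal for that cut.\<close>

section \<open>The matrix exponential\<close>

text \<open>The Euclidean norm of matrices does not give the identity norm \<open>1\<close>, so the library exponential
  is available only on a copy of the endomorphism algebra carrying the operator norm.\<close>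
typedef 'm endo = "UNIV :: ((real^'m::finite) \<Rightarrow>\<^sub>L (real^'m)) set" by simp
setup_lifting type_definition_endo

instantiation endo :: (finite) real_algebra_1
begin
lift_definition zero_endo :: "'a endo" is 0 .
lift_definition one_endo :: "'a endo" is id_blinfun .
lift_definition plus_endo :: "'a endo \<Rightarrow> 'a endo \<Rightarrow> 'a endo" is "(+)" .
lift_definition minus_endo :: "'a endo \<Rightarrow> 'a endo \<Rightarrow> 'a endo" is "(-)" .
lift_definition uminus_endo :: "'a endo \<Rightarrow> 'a endo" is uminus .
lift_definition times_endo :: "'a endo \<Rightarrow> 'a endo \<Rightarrow> 'a endo" is "(o\<^sub>L)" .
lift_definition scaleR_endo :: "real \<Rightarrow> 'a endo \<Rightarrow> 'a endo" is "(*\<^sub>R)" .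
instance
proof
  show "(0::'a endo) \<noteq> 1" by transfer (metis norm_blinfun_id norm_zero zero_neq_one)
qed (transfer; force simp: algebra_simps blinfun.bilinear_simps intro!: blinfun_eqI)+
end

instantiation endo :: (finite) real_normed_algebra_1
begin
lift_definition norm_endo :: "'a endo \<Rightarrow> real" is norm .
definition dist_endo :: "'a endo \<Rightarrow> 'a endo \<Rightarrow> real" where "dist_endo x y = norm (x - y)"
definition sgn_endo :: "'a endo \<Rightarrow> 'a endo" where "sgn_endo x = x /\<^sub>R norm x"
definition uniformity_endo :: "('a endo \<times> 'a endo) filter" where
  "uniformity_endo = (INF e\<in>{0<..}. principal {(x, y). dist x y < e})"
definition open_endo :: "'a endo set \<Rightarrow> bool" where
  "open_endo U = (\<forall>x\<in>U. \<forall>\<^sub>F (x', y) in uniformity. x' = x \<longrightarrow> y \<in> U)"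
instance
proof
  show "norm (x * y) \<le> norm x * norm y" for x y :: "'a endo"
    by transfer (rule norm_blinfun_compose)
  show "norm (1::'a endo) = 1" by transfer simp
  show "norm (x + y) \<le> norm x + norm y" for x y :: "'a endo"
    by transfer (rule norm_triangle_ineq)
qed (simp add: dist_endo_def sgn_endo_def uniformity_endo_def open_endo_def | transfer, simp)+
end

instance endo :: (finite) banach
proof
  fix X :: "nat \<Rightarrow> 'a endo" assume "Cauchy X"
  then have "Cauchy (\<lambda>n. Rep_endo (X n))"
    unfolding Cauchy_def dist_norm by (simp add: minus_endo.rep_eq norm_endo.rep_eq)
  then obtain L where "(\<lambda>n. Rep_endo (X n)) \<longlonglongrightarrow> L"
    using Cauchy_convergent_iff convergent_def by blast
  then have "X \<longlonglongrightarrow> Abs_endo L"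
    unfolding LIMSEQ_iff by (simp add: minus_endo.rep_eq norm_endo.rep_eq Abs_endo_inverse)
  then show "convergent X" by (auto simp: convergent_def)
qed

text \<open>The exponential series converges uniformly on balls by the Weierstrass test. The radius
  \<open>norm l + 1\<close> puts \<open>l\<close> in the interior of the ball, which gives
  continuity at \<open>l\<close>.\<close>

lemma tendsto_exp_banach:
  fixes f :: "'a \<Rightarrow> 'b::{real_normed_algebra_1,banach}"
  assumes "(f \<longlongrightarrow> l) F"
  shows "((\<lambda>x. exp (f x)) \<longlongrightarrow> exp l) F"
proof -
  define r where "r = norm l + 1"
  have "uniform_limit (cball 0 r) (\<lambda>n (x::'b). \<Sum>i<n. x ^ i /\<^sub>R fact i) (\<lambda>x. \<Sum>i. x ^ i /\<^sub>R fact i) sequentially"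
  proof (rule Weierstrass_m_test)
    fix n and x :: 'b assume "x \<in> cball 0 r"
    then have "norm x ^ n \<le> r ^ n" by (intro power_mono) auto
    then show "norm (x ^ n /\<^sub>R fact n) \<le> r ^ n /\<^sub>R fact n"
      by (simp add: divide_simps order_trans[OF norm_power_ineq])
  qed (rule summable_exp_generic)
  then have "continuous_on (cball 0 r) (exp :: 'b \<Rightarrow> 'b)"
    unfolding exp_def
    by (rule uniform_limit_theorem[rotated]) (auto intro!: always_eventually continuous_intros)
  then have "isCont (exp :: 'b \<Rightarrow> 'b) l"
    by (rule continuous_on_interior) (simp add: r_def interior_cball)
  then show ?thesis using assms by (rule isCont_tendsto_compose)
qed

section \<open>Passing between matrices and endomorphisms\<close>

definition endo_of :: "'m::finite mtx \<Rightarrow> 'm endo" where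
  "endo_of A = Abs_endo (Blinfun ((*v) A))"

definition mtx_of :: "'m::finite endo \<Rightarrow> 'm mtx" where
  "mtx_of T = matrix (blinfun_apply (Rep_endo T))"

lemma Rep_endo_of: "blinfun_apply (Rep_endo (endo_of A)) = (*v) A"
  by (simp add: endo_of_def Abs_endo_inverse bounded_linear_Blinfun_apply
      matrix_vector_mul_bounded_linear)

lemma mtx_of_endo_of [simp]: "mtx_of (endo_of A) = A"
  by (simp add: mtx_of_def Rep_endo_of matrix_of_matrix_vector_mul)

lemma endo_eqI: "(\<And>x. blinfun_apply (Rep_endo S) x = blinfun_apply (Rep_endo T) x) \<Longrightarrow> S = T"
  by (metis Rep_endo_inject blinfun_eqI)

lemma bounded_linear_endo_of: "bounded_linear (endo_of :: 'm::finite mtx \<Rightarrow> 'm endo)"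
proof -
  have "linear (endo_of :: 'm mtx \<Rightarrow> 'm endo)"
    by (rule linearI; rule endo_eqI) (simp_all add: Rep_endo_of plus_endo.rep_eq scaleR_endo.rep_eq
        blinfun.bilinear_simps matrix_vector_mult_add_rdistrib scaleR_matrix_vector_assoc)
  then show ?thesis by (rule linear_conv_bounded_linear[THEN iffD1])
qed

lemma norm_mtx_le: "norm (A :: 'm::finite mtx) \<le> (\<Sum>i\<in>UNIV. \<Sum>j\<in>UNIV. \<bar>A $ i $ j\<bar>)"
proof -
  have "norm A \<le> (\<Sum>i\<in>UNIV. norm (A $ i))"
    by (simp add: norm_vec_def L2_set_le_sum)
  also have "\<dots> \<le> (\<Sum>i\<in>UNIV. \<Sum>j\<in>UNIV. \<bar>A $ i $ j\<bar>)"
    by (intro sum_mono norm_le_l1_cart)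
  finally show ?thesis .
qed

text \<open>Each entry is a coordinate of the image of a unit vector, hence at most the operator
  norm; the constant counts the entries.\<close>

lemma bounded_linear_mtx_of: "bounded_linear (mtx_of :: 'm::finite endo \<Rightarrow> 'm mtx)"
proof (rule bounded_linear_intro[where K="real CARD('m) * real CARD('m)"])
  fix S T :: "'m endo" and c :: real
  show "mtx_of (S + T) = mtx_of S + mtx_of T"
    by (simp add: mtx_of_def matrix_def vec_eq_iff plus_endo.rep_eq blinfun.bilinear_simps)
  show "mtx_of (c *\<^sub>R T) = c *\<^sub>R mtx_of T"
    by (simp add: mtx_of_def matrix_def vec_eq_iff scaleR_endo.rep_eq blinfun.bilinear_simps)
  have entry: "\<bar>mtx_of T $ i $ j\<bar> \<le> norm T" for i j
  proof -
    have "\<bar>mtx_of T $ i $ j\<bar> \<le> norm (blinfun_apply (Rep_endo T) (axis j 1))"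
      using Finite_Cartesian_Product.norm_nth_le[of "blinfun_apply (Rep_endo T) (axis j 1)" i]
      by (simp add: mtx_of_def matrix_def)
    also have "\<dots> \<le> norm (Rep_endo T) * norm (axis j 1 :: real^'m)"
      by (rule norm_blinfun)
    finally show ?thesis by (simp add: norm_endo.rep_eq)
  qed
  have "norm (mtx_of T) \<le> (\<Sum>i\<in>(UNIV::'m set). \<Sum>j\<in>(UNIV::'m set). norm T)"
    by (intro order_trans[OF norm_mtx_le] sum_mono entry)
  also have "\<dots> = norm T * (real CARD('m) * real CARD('m))"
    by simp
  finally show "norm (mtx_of T) \<le> norm T * (real CARD('m) * real CARD('m))" .
qed

lemma endo_of_mult: "endo_of (A ** B) = endo_of A * endo_of B"
  by (rule endo_eqI) (simp add: Rep_endo_of times_endo.rep_eq matrix_vector_mul_assoc)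

lemma endo_of_one: "endo_of (mat 1) = 1"
  by (rule endo_eqI) (simp add: Rep_endo_of one_endo.rep_eq)

lemma mtx_of_mult: "mtx_of (S * T) = mtx_of S ** mtx_of T"
  by (simp add: mtx_of_def times_endo.rep_eq blinfun_compose.rep_eq matrix_compose bounded_linear.linear blinfun.bounded_linear_right)

lemma endo_of_mpow: "endo_of (mpow A n) = endo_of A ^ n"
  by (induction n) (simp_all add: endo_of_mult endo_of_one)

text \<open>\<open>mtx_of\<close> is continuous, linear and undoes \<open>endo_of\<close>, so it
  carries the exponential series termwise to the one behind \<open>mexp\<close>. This also shows
  that the latter series converges, which a definition by an infinite sum does not provide.\<close>

lemma mexp_sums: "(\<lambda>k. (1 / fact k) *\<^sub>R mpow A k) sums mexp A"
  and mexp_eq_exp: "mexp A = mtx_of (exp (endo_of A))"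
proof -
  have "(\<lambda>k. mtx_of (endo_of A ^ k /\<^sub>R fact k)) sums mtx_of (exp (endo_of A))"
    by (rule bounded_linear.sums[OF bounded_linear_mtx_of exp_converges])
  moreover have "mtx_of (endo_of A ^ k /\<^sub>R fact k) = (1 / fact k) *\<^sub>R mpow A k" for k
    by (simp add: linear_cmul[OF bounded_linear.linear[OF bounded_linear_mtx_of]] divide_inverse flip: endo_of_mpow)
  ultimately have *: "(\<lambda>k. (1 / fact k) *\<^sub>R mpow A k) sums mtx_of (exp (endo_of A))" by simp
  then show "mexp A = mtx_of (exp (endo_of A))" by (simp add: mexp_def sums_iff)
  with * show "(\<lambda>k. (1 / fact k) *\<^sub>R mpow A k) sums mexp A" by simp
qed

lemma tendsto_mexp: "(f \<longlongrightarrow> A) F \<Longrightarrow> ((\<lambda>x. mexp (f x)) \<longlongrightarrow> mexp A) F"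
  unfolding mexp_eq_exp
  by (intro bounded_linear.tendsto[OF bounded_linear_mtx_of] tendsto_exp_banach
      bounded_linear.tendsto[OF bounded_linear_endo_of])

lemma mexp_0 [simp]: "mexp 0 = mat 1"
  by (simp add: mexp_eq_exp linear_0[OF bounded_linear.linear[OF bounded_linear_endo_of]] flip: endo_of_one)

lemma mexp_minus_mult: "mexp (- A) ** mexp A = mat 1"
proof -
  have "endo_of (- A) = - endo_of A"
    by (simp add: linear_neg[OF bounded_linear.linear[OF bounded_linear_endo_of]])
  then have "mexp (- A) ** mexp A = mtx_of (exp (- endo_of A) * exp (- (- endo_of A)))"
    by (simp add: mexp_eq_exp mtx_of_mult)
  also have "\<dots> = mat 1" by (subst exp_minus_inverse) (simp flip: endo_of_one)
  finally show ?thesis .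
qed

lemma mexp_has_vector_derivative_0:
  "((\<lambda>t. mexp (t *\<^sub>R A)) has_vector_derivative A) (at 0)"
proof -
  have "((\<lambda>t. exp (t *\<^sub>R endo_of A)) has_vector_derivative endo_of A) (at 0)"
    using exp_scaleR_has_vector_derivative_left[of "endo_of A" 0] by simp
  from bounded_linear.has_vector_derivative[OF bounded_linear_mtx_of this] show ?thesis
    by (simp add: mexp_eq_exp linear_cmul[OF bounded_linear.linear[OF bounded_linear_endo_of]])
qed

text \<open>A linear map on matrices is continuous and may be applied termwise to the series.
  Conjugation and transposition are the two uses.\<close>

lemma mexp_intertwine:
  fixes f :: "'m::finite mtx \<Rightarrow> 'm mtx"
  assumes "linear f" and "\<And>k. f (mpow A k) = mpow B k"
  shows "f (mexp A) = mexp B"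
proof -
  have "(\<lambda>k. f ((1 / fact k) *\<^sub>R mpow A k)) sums f (mexp A)"
    by (intro bounded_linear.sums[OF _ mexp_sums] assms(1)[THEN linear_conv_bounded_linear[THEN iffD1]])
  then have "(\<lambda>k. (1 / fact k) *\<^sub>R mpow B k) sums f (mexp A)"
    by (simp add: linear_cmul[OF assms(1)] assms(2))
  then show ?thesis using mexp_sums by (rule sums_unique2)
qed

lemma bounded_bilinear_mtx_mult: "bounded_bilinear ((**) :: 'm::finite mtx \<Rightarrow> 'm mtx \<Rightarrow> 'm mtx)"
proof -
  have "bilinear ((**) :: 'm mtx \<Rightarrow> 'm mtx \<Rightarrow> 'm mtx)"
    unfolding bilinear_def
    by (auto intro!: linearI simp: matrix_matrix_mult_def vec_eq_iff sum.distrib algebra_simps sum_distrib_left)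
  then show ?thesis by (simp add: bilinear_conv_bounded_bilinear)
qed

interpretation mtx_mult: bounded_bilinear "(**) :: 'm::finite mtx \<Rightarrow> 'm mtx \<Rightarrow> 'm mtx"
  by (rule bounded_bilinear_mtx_mult)

text \<open>Everything rests on \<open>y - b = y * ((a - x) * b)\<close>: once the second factor is
  small, \<open>y\<close> is bounded, and then the difference tends to zero.\<close>

lemma tendsto_mtx_inverse:
  fixes A :: "'m::finite mtx"
  assumes "(X \<longlongrightarrow> A) F" and inv: "\<And>n. Y n ** X n = mat 1" and "B ** A = mat 1"
  shows "(Y \<longlongrightarrow> B) F"
proof -
  have AB: "A ** B = mat 1" using assms(3) by (simp add: matrix_left_right_inverse)
  define x y a b where "x n = endo_of (X n)" and "y n = endo_of (Y n)"
    and "a = endo_of A" and "b = endo_of B" for n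
  have x: "(x \<longlongrightarrow> a) F"
    unfolding x_def a_def by (rule bounded_linear.tendsto[OF bounded_linear_endo_of assms(1)])
  have yx: "y n * x n = 1" and ab: "a * b = 1" for n
    by (simp_all add: x_def y_def a_def b_def inv AB endo_of_one flip: endo_of_mult)
  have diff: "y n - b = y n * ((a - x n) * b)" for n
    using arg_cong[OF yx[of n], of "\<lambda>z. z * b"]
    by (simp add: algebra_simps mult.assoc ab)
  have lim: "((\<lambda>n. norm ((a - x n) * b)) \<longlongrightarrow> 0) F"
    by (auto intro!: tendsto_eq_intros x)
  \<comment> \<open>Below \<open>1 / 2\<close> the identity gives
    \<open>norm (y n) \<le> norm b + norm (y n) / 2\<close>, hence the bound
    \<open>2 * norm b\<close>.\<close>
  then have "\<forall>\<^sub>F n in F. norm ((a - x n) * b) < 1 / 2"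
    by (rule order_tendstoD) simp
  then have "\<forall>\<^sub>F n in F. norm (y n - b) \<le> 2 * norm b * norm ((a - x n) * b)"
  proof eventually_elim
    case (elim n)
    have le: "norm (y n - b) \<le> norm (y n) * norm ((a - x n) * b)"
      by (subst diff) (rule norm_mult_ineq)
    also have "\<dots> \<le> norm (y n) * (1 / 2)"
      using elim by (intro mult_left_mono) auto
    finally have "norm (y n) \<le> 2 * norm b"
      using norm_triangle_ineq2[of "y n" b] by linarith
    then have "norm (y n) * norm ((a - x n) * b) \<le> 2 * norm b * norm ((a - x n) * b)"
      by (intro mult_right_mono) auto
    with le show ?case by linarith
  qed
  moreover have "((\<lambda>n. 2 * norm b * norm ((a - x n) * b)) \<longlongrightarrow> 0) F"
    using tendsto_mult_right_zero[OF lim] by simp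
  ultimately have "((\<lambda>n. y n - b) \<longlongrightarrow> 0) F"
    by (rule Lim_null_comparison)
  then have "(y \<longlongrightarrow> b) F" by (simp add: LIM_zero_iff)
  from bounded_linear.tendsto[OF bounded_linear_mtx_of this] show ?thesis
    by (simp add: y_def b_def)
qed

lemma mexp_conj:
  fixes A :: "'m::finite mtx"
  assumes "A' ** A = mat 1" shows "mexp (A ** X ** A') = A ** mexp X ** A'"
proof (rule sym, rule mexp_intertwine)
  show "linear (\<lambda>X. A ** X ** A')"
    by (rule linearI) (simp_all add: mtx_mult.add_left mtx_mult.add_right mtx_mult.scaleR_left mtx_mult.scaleR_right)
  have AA': "A ** A' = mat 1" using assms by (simp add: matrix_left_right_inverse)
  show "A ** mpow X k ** A' = mpow (A ** X ** A') k" for k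
  proof (induction k)
    case (Suc k)
    have "mpow (A ** X ** A') (Suc k) = A ** X ** A' ** (A ** mpow X k ** A')"
      by (simp add: Suc)
    also have "\<dots> = A ** X ** (A' ** A) ** mpow X k ** A'"
      by (simp only: matrix_mul_assoc)
    also have "\<dots> = A ** mpow X (Suc k) ** A'"
      by (simp add: assms matrix_mul_assoc)
    finally show ?case ..
  qed (simp add: AA')
qed

text \<open>\<open>mpow\<close> multiplies on the left, whereas transposition reverses products;
  this reconciles the two in \<open>mexp_transpose\<close>.\<close>

lemma mpow_comm: "mpow A k ** A = A ** mpow A k"
  by (induction k) (simp_all flip: matrix_mul_assoc)

lemma mexp_transpose: "mexp (transpose A) = transpose (mexp A)"
proof (rule sym, rule mexp_intertwine)
  show "linear (transpose :: 'a mtx \<Rightarrow> 'a mtx)"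
    by (rule linearI) (simp_all add: transpose_def vec_eq_iff)
  show "transpose (mpow A k) = mpow (transpose A) k" for k
    by (induction k) (simp_all add: matrix_transpose_mul flip: mpow_comm)
qed

section \<open>The group O(p,q) and its Lie algebra\<close>

definition sg :: "'m set \<Rightarrow> 'm \<Rightarrow> real" where
  "sg P i = (if i \<in> P then -1 else 1)"

definition diagm :: "('m::finite \<Rightarrow> real) \<Rightarrow> 'm mtx" where
  "diagm d = (\<chi> i j. if i = j then d i else 0)"

text \<open>This is the condition \<open>transpose X ** form_mat P + form_mat P ** X = 0\<close>
  read entry by entry, a form suited to the entrywise rescalings used later.\<close>

definition so_pq :: "'m::finite set \<Rightarrow> 'm mtx set" where
  "so_pq P = {X. \<forall>i j. X$i$j + sg P i * sg P j * X$j$i = 0}"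

lemma so_pqD: "X \<in> so_pq P \<Longrightarrow> X$i$j = - (sg P i * sg P j * X$j$i)"
  by (simp add: so_pq_def eq_neg_iff_add_eq_0)

lemma so_pqI: "(\<And>i j. X$i$j = - (sg P i * sg P j * X$j$i)) \<Longrightarrow> X \<in> so_pq P"
  by (simp add: so_pq_def eq_neg_iff_add_eq_0)

lemma sg_mult_self [simp]: "sg P i * sg P i = 1" "sg P i * (sg P i * x) = x"
  by (simp_all add: sg_def)

lemma diagm_mult [simp]: "(diagm d ** A) $ i $ j = d i * A $ i $ j"
  by (simp add: diagm_def matrix_matrix_mult_def if_distrib[of "\<lambda>x. x * _"] cong: if_cong)

lemma mult_diagm [simp]: "(A ** diagm d) $ i $ j = A $ i $ j * d j"
  by (simp add: diagm_def matrix_matrix_mult_def if_distrib[of "\<lambda>x. _ * x"] cong: if_cong)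

lemma diagm_mult_diagm: "diagm c ** diagm d = diagm (\<lambda>i. c i * d i)"
  by (simp add: vec_eq_iff) (simp add: diagm_def)

lemma diagm_one: "diagm (\<lambda>i. 1) = mat 1"
  by (simp add: diagm_def mat_def)

lemma transpose_diagm [simp]: "transpose (diagm d) = diagm d"
  by (simp add: diagm_def transpose_def vec_eq_iff)

lemma diagm_inverse:
  assumes "\<And>i. d i \<noteq> 0"
  shows "diagm d ** diagm (\<lambda>i. inverse (d i)) = mat 1" "diagm (\<lambda>i. inverse (d i)) ** diagm d = mat 1"
  using assms by (simp_all add: diagm_mult_diagm flip: diagm_one)

lemma form_mat_eq_diagm: "form_mat P = diagm (sg P)"
  by (simp add: form_mat_def diagm_def sg_def vec_eq_iff)

lemma form_mat_mult_self: "form_mat P ** form_mat P = mat 1"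
  by (simp add: form_mat_eq_diagm diagm_mult_diagm diagm_one)

lemma O_pq_left_inverse:
  assumes "h \<in> O_pq P"
  shows "(form_mat P ** transpose h ** form_mat P) ** h = mat 1"
proof -
  have "(form_mat P ** transpose h ** form_mat P) ** h = form_mat P ** (transpose h ** form_mat P ** h)"
    by (simp only: matrix_mul_assoc)
  then show ?thesis using assms by (simp add: O_pq_def form_mat_mult_self)
qed

lemma O_pq_one: "mat 1 \<in> O_pq P"
  by (simp add: O_pq_def)

lemma O_pq_mult:
  assumes "g \<in> O_pq P" "h \<in> O_pq P" shows "g ** h \<in> O_pq P"
proof -
  have "transpose (g ** h) ** form_mat P ** (g ** h) = transpose h ** (transpose g ** form_mat P ** g) ** h"
    by (simp add: matrix_transpose_mul matrix_mul_assoc)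
  then show ?thesis using assms by (simp add: O_pq_def)
qed

lemma O_pq_inverse:
  assumes "h \<in> O_pq P"
  obtains h' where "h' \<in> O_pq P" "h' ** h = mat 1" "h ** h' = mat 1"
proof
  define h' where "h' = form_mat P ** transpose h ** form_mat P"
  show l: "h' ** h = mat 1"
    unfolding h'_def by (rule O_pq_left_inverse[OF assms])
  then show r: "h ** h' = mat 1"
    by (simp add: matrix_left_right_inverse)
  have "transpose h' ** form_mat P ** h' = transpose h' ** (transpose h ** form_mat P ** h) ** h'"
    using assms by (simp add: O_pq_def)
  also have "\<dots> = transpose (h ** h') ** form_mat P ** (h ** h')"
    by (simp add: matrix_transpose_mul matrix_mul_assoc)
  finally show "h' \<in> O_pq P" by (simp add: O_pq_def r)
qed

text \<open>Membership in so(p,q) says that \<open>transpose X\<close> is the conjugate of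
  \<open>- X\<close> by the involution \<open>form_mat P\<close>; exponentiating gives the same
  relation between \<open>transpose (mexp X)\<close> and \<open>mexp (- X)\<close>.\<close>

lemma mexp_in_O_pq:
  assumes "X \<in> so_pq P" shows "mexp X \<in> O_pq P"
proof -
  have "transpose X = form_mat P ** (- X) ** form_mat P"
    unfolding vec_eq_iff
  proof (intro allI)
    show "transpose X $ i $ j = (form_mat P ** (- X) ** form_mat P) $ i $ j" for i j
      using so_pqD[OF assms, of j i] by (simp add: form_mat_eq_diagm transpose_def mult_ac)
  qed
  then have "transpose (mexp X) = form_mat P ** mexp (- X) ** form_mat P"
    by (metis mexp_transpose mexp_conj form_mat_mult_self)
  then have "transpose (mexp X) ** form_mat P ** mexp X
      = form_mat P ** mexp (- X) ** (form_mat P ** form_mat P) ** mexp X"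
    by (simp only: matrix_mul_assoc)
  also have "\<dots> = form_mat P ** (mexp (- X) ** mexp X)"
    by (simp only: form_mat_mult_self matrix_mul_rid matrix_mul_assoc)
  also have "\<dots> = form_mat P" by (simp add: mexp_minus_mult)
  finally show ?thesis by (simp add: O_pq_def)
qed

lemma O_pq_imp_PO_pq: "g \<in> O_pq P \<Longrightarrow> g \<in> PO_pq P"
  unfolding PO_pq_def by (intro CollectI exI[of _ 1] exI[of _ g]) simp

lemma mtx_left_inverse_unique:
  fixes A B C :: "'m::finite mtx"
  assumes "B ** A = mat 1" "C ** A = mat 1" shows "B = C"
proof -
  have "A ** B = mat 1" using assms(1) by (simp add: matrix_left_right_inverse)
  then have "C = C ** A ** B" by (simp flip: matrix_mul_assoc)
  then show ?thesis by (simp add: assms(2))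
qed

text \<open>The factors at \<open>(k, k)\<close> cancel the scalar relating \<open>g'\<close> to \<open>form_mat P ** transpose g ** form_mat P\<close>.\<close>
lemma PO_pq_inverse_entries:
  assumes "g \<in> PO_pq P" and "g' ** g = mat 1"
  shows "g'$i$j * g$k$k = sg P i * sg P j * g$j$i * g'$k$k"
proof -
  obtain c h where c: "c \<noteq> 0" and h: "h \<in> O_pq P" and g: "g = c *\<^sub>R h"
    using assms(1) by (auto simp: PO_pq_def)
  have "((1/c) *\<^sub>R (form_mat P ** transpose h ** form_mat P)) ** g = mat 1"
    using c O_pq_left_inverse[OF h] by (simp add: g mtx_mult.scaleR_left mtx_mult.scaleR_right)
  then have "(1/c) *\<^sub>R (form_mat P ** transpose h ** form_mat P) = g'"
    by (rule mtx_left_inverse_unique) (rule assms(2))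
  from this[symmetric] have "g' $ i $ j = sg P i * sg P j * h$j$i / c" for i j
    by (simp add: form_mat_eq_diagm transpose_def)
  then show ?thesis using c by (simp add: g)
qed

lemma so_pq_subspace: "subspace (so_pq P)"
  unfolding subspace_def
proof (intro conjI ballI allI)
  show "x + y \<in> so_pq P" if "x \<in> so_pq P" "y \<in> so_pq P" for x y
  proof (rule so_pqI)
    show "(x + y)$i$j = - (sg P i * sg P j * (x + y)$j$i)" for i j
      using so_pqD[OF that(1), of i j] so_pqD[OF that(2), of i j] by (simp add: algebra_simps)
  qed
  show "c *\<^sub>R x \<in> so_pq P" if "x \<in> so_pq P" for c x
  proof (rule so_pqI)
    show "(c *\<^sub>R x)$i$j = - (sg P i * sg P j * (c *\<^sub>R x)$j$i)" for i j
      using so_pqD[OF that, of i j] by simp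
  qed
qed (simp add: so_pq_def)

lemma so_pq_diag: "X \<in> so_pq P \<Longrightarrow> X$i$i = 0"
  using so_pqD[of X P i i] by simp

text \<open>Both sides are differentiated at \<open>t = 0\<close>, where the exponentials are the
  identity. The conditional terms come from differentiating the factor at \<open>(k, k)\<close>
  against the Kronecker delta.\<close>

lemma mexp_entries_derivative:
  fixes X :: "'m::finite mtx"
  assumes "\<And>t. mexp (t *\<^sub>R (- X))$i$j * mexp (t *\<^sub>R X)$k$k = \<rho> * mexp (t *\<^sub>R X)$j$i * mexp (t *\<^sub>R (- X))$k$k"
  shows "- X$i$j + (if i = j then X$k$k else 0) = \<rho> * (X$j$i - (if i = j then X$k$k else 0))"
proof -
  have d: "((\<lambda>t. mexp (t *\<^sub>R A)$a$b) has_real_derivative A$a$b) (at 0)" for A :: "'m mtx" and a b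
    using bounded_linear.has_vector_derivative[OF bounded_linear_compose[OF bounded_linear_vec_nth bounded_linear_vec_nth]
        mexp_has_vector_derivative_0[of A]]
    by (simp add: o_def has_real_derivative_iff_has_vector_derivative)
  have l: "((\<lambda>t. mexp (t *\<^sub>R (- X))$i$j * mexp (t *\<^sub>R X)$k$k) has_real_derivative
      - X$i$j + (if i = j then X$k$k else 0)) (at 0)"
    using DERIV_mult[OF d[of "- X" i j] d[of X k k]] by (auto simp: mat_def algebra_simps)
  have r: "((\<lambda>t. \<rho> * mexp (t *\<^sub>R X)$j$i * mexp (t *\<^sub>R (- X))$k$k) has_real_derivative
      \<rho> * (X$j$i - (if i = j then X$k$k else 0))) (at 0)"
    using DERIV_cmult[OF DERIV_mult[OF d[of X j i] d[of "- X" k k]], of \<rho>] by (auto simp: mat_def algebra_simps)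
  show ?thesis using l r unfolding assms by (rule DERIV_unique)
qed

text \<open>On the diagonal the differentiated relation makes all diagonal entries equal, and trace
  zero makes them vanish, which removes the scalar ambiguity of PGL. \<open>R\<close> marks the
  index pairs for which the relation is available; in a limit these need not be all pairs.\<close>

lemma mexp_entries_tangent:
  fixes X :: "'m::finite mtx"
  assumes tr: "trace X = 0" and R: "\<And>i. R i i" "\<And>i. \<rho> i i = 1"
    and rel: "\<And>t i j k. R i j \<Longrightarrow> mexp (t *\<^sub>R (- X))$i$j * mexp (t *\<^sub>R X)$k$k
      = \<rho> i j * mexp (t *\<^sub>R X)$j$i * mexp (t *\<^sub>R (- X))$k$k"
    and "R i j"
  shows "X$i$j = - (\<rho> i j * X$j$i)"
proof -
  have eq: "X$a$a = X$k$k" for a k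
    using mexp_entries_derivative[of X a a k, OF rel[OF R(1)]] by (simp add: R)
  then have "trace X = real CARD('m) * X$i$i"
    unfolding trace_def by (subst sum.cong[OF refl eq[of _ i]]) simp
  then have "X$i$i = 0" using tr by simp
  then have z: "X$k$k = 0" for k using eq[of k i] by simp
  show ?thesis
    using mexp_entries_derivative[of X i j i, OF rel[OF assms(5)]] z by (cases "i = j") auto
qed

text \<open>One inclusion exponentiates; the other differentiates
  \<open>PO_pq_inverse_entries\<close> along the one-parameter group, whose inverses are the
  exponentials of \<open>- X\<close>.\<close>

lemma lie_pgl_PO_pq: "lie_pgl (PO_pq P) = so_pq P"
proof (intro equalityI subsetI)
  fix X assume "X \<in> so_pq P"
  then have "t *\<^sub>R X \<in> so_pq P" for t
    using so_pq_subspace subspace_scale by blast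
  then have "mexp (t *\<^sub>R X) \<in> PO_pq P" for t
    by (intro O_pq_imp_PO_pq mexp_in_O_pq)
  moreover have "trace X = 0"
    using so_pq_diag[OF \<open>X \<in> so_pq P\<close>] by (simp add: trace_def)
  ultimately show "X \<in> lie_pgl (PO_pq P)" by (simp add: lie_pgl_def)
next
  fix X assume X: "X \<in> lie_pgl (PO_pq P)"
  have "X$i$j = - (sg P i * sg P j * X$j$i)" for i j
  proof (rule mexp_entries_tangent[where R = "\<lambda>i j. True" and \<rho> = "\<lambda>i j. sg P i * sg P j"])
    fix t i j k
    show "mexp (t *\<^sub>R (- X))$i$j * mexp (t *\<^sub>R X)$k$k
      = (sg P i * sg P j) * mexp (t *\<^sub>R X)$j$i * mexp (t *\<^sub>R (- X))$k$k"
      using X by (intro PO_pq_inverse_entries)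
        (auto simp: lie_pgl_def mexp_minus_mult scaleR_minus_right)
  qed (use X in \<open>auto simp: lie_pgl_def\<close>)
  then show "X \<in> so_pq P" by (rule so_pqI)
qed

section \<open>Contractions along block-diagonal subalgebras\<close>

text \<open>The commutator with a weight on each path from \<open>j\<close> through \<open>m\<close>
  to \<open>i\<close>. Every bracket of the contraction chain has this form, and a contraction
  changes only the weights.\<close>

definition weighted_bracket :: "('m \<Rightarrow> 'm \<Rightarrow> 'm \<Rightarrow> real) \<Rightarrow> 'm::finite mtx \<Rightarrow> 'm mtx \<Rightarrow> 'm mtx" where
  "weighted_bracket c X Y = (\<chi> i j. \<Sum>m\<in>UNIV. c i m j * (X$i$m * Y$m$j - Y$i$m * X$m$j))"

lemma weighted_bracket_one: "weighted_bracket (\<lambda>i m j. 1) = commutator"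
  by (simp add: fun_eq_iff weighted_bracket_def commutator_def matrix_matrix_mult_def vec_eq_iff sum_subtractf)

text \<open>The relation defining so(p,q) reverses the path from \<open>j\<close> through
  \<open>m\<close> to \<open>i\<close>, so weights invariant under reversal keep the bracket
  inside.\<close>

lemma weighted_bracket_in_so_pq:
  assumes "X \<in> so_pq P" "Y \<in> so_pq P" and "\<And>i m j. c i m j = c j m i"
  shows "weighted_bracket c X Y \<in> so_pq P"
proof -
  have *: "c i m j * (X$i$m * Y$m$j - Y$i$m * X$m$j)
      = - (sg P i * sg P j * (c j m i * (X$j$m * Y$m$i - Y$j$m * X$m$i)))" for i m j
  proof -
    have "X$i$m = - (sg P i * sg P m * X$m$i)" "Y$m$j = - (sg P m * sg P j * Y$j$m)"
       "Y$i$m = - (sg P i * sg P m * Y$m$i)" "X$m$j = - (sg P m * sg P j * X$j$m)"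
      by (rule so_pqD, fact)+
    note eqs = this
    show ?thesis unfolding assms(3)[of i m j] eqs by (simp add: algebra_simps)
  qed
  show ?thesis
    unfolding weighted_bracket_def
    by (intro so_pqI, simp only: vec_lambda_beta sum_distrib_left sum_negf[symmetric])
      (intro sum.cong refl *)
qed

text \<open>\<open>u\<close> splits the indices into two classes; \<open>T\<close> is the block
  diagonal part and \<open>Tc\<close> the off-diagonal part. Only paths that change class twice lose
  their weight in the limit.\<close>

lemma is_contraction_weighted_bracket:
  fixes P :: "'m::finite set" and u :: "'m \<Rightarrow> bool" and c :: "'m \<Rightarrow> 'm \<Rightarrow> 'm \<Rightarrow> real"
  defines "T \<equiv> {X \<in> so_pq P. \<forall>i j. u i \<noteq> u j \<longrightarrow> X$i$j = 0}"
    and "Tc \<equiv> {X \<in> so_pq P. \<forall>i j. u i = u j \<longrightarrow> X$i$j = 0}"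
  assumes sym: "\<And>i m j. c i m j = c j m i"
  shows "is_contraction (so_pq P) (weighted_bracket c) T Tc
     (weighted_bracket (\<lambda>i m j. if u i \<noteq> u m \<and> u m \<noteq> u j then 0 else c i m j))"
proof -
  let ?V = "so_pq P"
  \<comment> \<open>On so(p,q) this is the explicit form of \<open>phi_contr\<close>;
    \<open>E 0\<close> is the projection onto \<open>T\<close>.\<close>
  define E where "E \<epsilon> X = (\<chi> i j. (if u i = u j then 1 else \<epsilon>) * X$i$j)" for \<epsilon> and X :: "'m mtx"
  have subT: "subspace T" and subTc: "subspace Tc"
    unfolding subspace_def T_def Tc_def using so_pq_subspace[of P] by (auto simp: subspace_def)
  have disj: "X = 0" if "X \<in> T" "X \<in> Tc" for X
    using that by (auto simp: T_def Tc_def vec_eq_iff)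
  have E_in: "E \<epsilon> X \<in> ?V" if "X \<in> ?V" for \<epsilon> X
  proof (rule so_pqI)
    show "E \<epsilon> X $ i $ j = - (sg P i * sg P j * E \<epsilon> X $ j $ i)" for i j
      using so_pqD[OF that, of i j] by (simp add: E_def)
  qed
  have E0T: "E 0 X \<in> T" if "X \<in> ?V" for X
    using E_in[OF that] by (simp add: T_def E_def)
  have E0Tc: "X - E 0 X \<in> Tc" if "X \<in> ?V" for X
    using that E_in[OF that, of 0] subspace_diff[OF so_pq_subspace] by (auto simp: Tc_def E_def)
  have split: "a = E 0 X" if "X \<in> ?V" "a \<in> T" "X - a \<in> Tc" for a X
    using disj[of "a - E 0 X"] subspace_diff[OF subT that(2) E0T[OF that(1)]]
      subspace_diff[OF subTc E0Tc[OF that(1)] that(3)] by simp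
  have proj: "proj_T T Tc X = E 0 X" if "X \<in> ?V" for X
    unfolding proj_T_def using E0T[OF that] E0Tc[OF that] split[OF that] by blast
  have phi: "phi_contr T Tc \<epsilon> X = E \<epsilon> X" if "X \<in> ?V" for \<epsilon> X
    unfolding phi_contr_def proj[OF that] by (auto simp: E_def vec_eq_iff)
  have "lie_subalgebra ?V (weighted_bracket c) T"
    unfolding lie_subalgebra_def
  proof (intro conjI ballI)
    fix X Y assume XY: "X \<in> T" "Y \<in> T"
    have "weighted_bracket c X Y $ i $ j = 0" if "u i \<noteq> u j" for i j
    proof -
      have "X$i$m * Y$m$j - Y$i$m * X$m$j = 0" for m
        using XY that by (cases "u i = u m"; auto simp: T_def)
      then show ?thesis by (simp add: weighted_bracket_def)
    qed
    with XY show "weighted_bracket c X Y \<in> T"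
      by (auto simp: T_def intro: weighted_bracket_in_so_pq sym)
  qed (rule subT, auto simp: T_def)
  moreover have "complementary ?V T Tc"
    unfolding complementary_def
  proof (intro conjI ballI)
    fix X assume X: "X \<in> ?V"
    show "\<exists>!p. fst p \<in> T \<and> snd p \<in> Tc \<and> X = fst p + snd p"
    proof (rule ex1I[of _ "(E 0 X, X - E 0 X)"])
      show "p = (E 0 X, X - E 0 X)" if "fst p \<in> T \<and> snd p \<in> Tc \<and> X = fst p + snd p" for p
        using split[OF X, of "fst p"] that by (auto simp: prod_eq_iff)
    qed (use E0T[OF X] E0Tc[OF X] in auto)
  qed (rule subT, rule subTc, auto simp: T_def Tc_def)
  moreover have "((\<lambda>\<epsilon>. inv_into ?V (phi_contr T Tc \<epsilon>)
                 (weighted_bracket c (phi_contr T Tc \<epsilon> X) (phi_contr T Tc \<epsilon> Y)))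
      \<longlongrightarrow> weighted_bracket (\<lambda>i m j. if u i \<noteq> u m \<and> u m \<noteq> u j then 0 else c i m j) X Y) (at_right 0)"
    if X: "X \<in> ?V" and Y: "Y \<in> ?V" for X Y
  proof -
    \<comment> \<open>Each change of class contributes one factor \<open>\<epsilon>\<close>, and the
      inverse map removes one factor when the endpoints differ in class. Hence a single change
      cancels, while a double one leaves \<open>\<epsilon>\<^sup>2\<close>.\<close>
    define w :: "real \<Rightarrow> 'm \<Rightarrow> 'm \<Rightarrow> 'm \<Rightarrow> real"
      where "w \<epsilon> i m j = (if u i \<noteq> u m \<and> u m \<noteq> u j then \<epsilon>\<^sup>2 * c i m j else c i m j)" for \<epsilon> i m j
    have w_in: "weighted_bracket (w \<epsilon>) X Y \<in> ?V" for \<epsilon>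
      using X Y by (rule weighted_bracket_in_so_pq) (auto simp: w_def sym)
    have "inv_into ?V (phi_contr T Tc \<epsilon>) (weighted_bracket c (phi_contr T Tc \<epsilon> X) (phi_contr T Tc \<epsilon> Y))
        = weighted_bracket (w \<epsilon>) X Y" if "\<epsilon> > 0" for \<epsilon>
    proof -
      have "inj_on (phi_contr T Tc \<epsilon>) ?V"
        using that by (intro inj_onI) (auto simp: phi E_def vec_eq_iff split: if_splits)
      moreover have "weighted_bracket c (E \<epsilon> X) (E \<epsilon> Y) = E \<epsilon> (weighted_bracket (w \<epsilon>) X Y)"
      proof -
        have *: "c i m j * (E \<epsilon> X $ i $ m * E \<epsilon> Y $ m $ j - E \<epsilon> Y $ i $ m * E \<epsilon> X $ m $ j)
            = (if u i = u j then 1 else \<epsilon>) * (w \<epsilon> i m j * (X $ i $ m * Y $ m $ j - Y $ i $ m * X $ m $ j))" for i m j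
          by (cases "u i"; cases "u m"; cases "u j"; simp add: E_def w_def power2_eq_square algebra_simps)
        have "E \<epsilon> (weighted_bracket (w \<epsilon>) X Y) $ i $ j = (if u i = u j then 1 else \<epsilon>) * weighted_bracket (w \<epsilon>) X Y $ i $ j" for i j
          by (simp add: E_def)
        then show ?thesis
          unfolding vec_eq_iff by (simp only: weighted_bracket_def vec_lambda_beta sum_distrib_left *) simp
      qed
      ultimately show ?thesis
        by (simp add: phi X Y) (metis inv_into_f_f phi w_in)
    qed
    then have "\<forall>\<^sub>F \<epsilon> in at_right 0. weighted_bracket (w \<epsilon>) X Y = inv_into ?V (phi_contr T Tc \<epsilon>)
                 (weighted_bracket c (phi_contr T Tc \<epsilon> X) (phi_contr T Tc \<epsilon> Y))"
      by (simp add: eventually_at_right_less eventually_mono[OF eventually_at_right_less])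
    moreover have "((\<lambda>\<epsilon>. weighted_bracket (w \<epsilon>) X Y) \<longlongrightarrow> weighted_bracket (w 0) X Y) (at_right 0)"
      unfolding weighted_bracket_def w_def by (intro tendsto_vec_lambda tendsto_sum tendsto_mult) (auto intro!: tendsto_eq_intros)
    moreover have "w 0 = (\<lambda>i m j. if u i \<noteq> u m \<and> u m \<noteq> u j then 0 else c i m j)"
      by (auto simp: w_def fun_eq_iff)
    ultimately show ?thesis by (simp add: tendsto_cong)
  qed
  ultimately show ?thesis unfolding is_contraction_def by blast
qed

text \<open>Multiplication from \<open>j\<close> through \<open>m\<close> to \<open>i\<close> survives the first \<open>l\<close> contractions
  iff it crosses each of the cuts below \<open>l\<close> at most once; it is scaled by \<open>\<epsilon>\<^sup>2\<close> by a cut that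
  it crosses twice.\<close>
definition cut_coeff :: "('m \<Rightarrow> nat) \<Rightarrow> nat \<Rightarrow> 'm \<Rightarrow> 'm \<Rightarrow> 'm \<Rightarrow> real" where
  "cut_coeff v l i m j = (if \<exists>k<l. (v i \<le> k) \<noteq> (v m \<le> k) \<and> (v m \<le> k) \<noteq> (v j \<le> k) then 0 else 1)"

lemma is_contraction_cut_coeff:
  "\<exists>T Tc. is_contraction (so_pq P) (weighted_bracket (cut_coeff v l)) T Tc (weighted_bracket (cut_coeff v (Suc l)))"
proof -
  have "cut_coeff v (Suc l) = (\<lambda>i m j. if (v i \<le> l) \<noteq> (v m \<le> l) \<and> (v m \<le> l) \<noteq> (v j \<le> l)
      then 0 else cut_coeff v l i m j)"
    unfolding cut_coeff_def fun_eq_iff less_Suc_eq by auto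
  moreover have "cut_coeff v l i m j = cut_coeff v l j m i" for i m j
    unfolding cut_coeff_def by (rule arg_cong[of _ _ "\<lambda>b. if b then 0 else 1"]) auto
  ultimately show ?thesis
    using is_contraction_weighted_bracket[of "cut_coeff v l" P "\<lambda>i. v i \<le> l"] by auto
qed

text \<open>After all cuts exactly the monotone paths survive, and these are the paths that occur in
  products of block lower triangular matrices.\<close>

lemma cut_coeff_between:
  assumes "\<And>i. v i \<le> s" and "v j \<le> v i"
  shows "cut_coeff v s i m j = (if v j \<le> v m \<and> v m \<le> v i then 1 else 0)"
proof -
  have "(\<exists>k<s. (v i \<le> k) \<noteq> (v m \<le> k) \<and> (v m \<le> k) \<noteq> (v j \<le> k)) \<longleftrightarrow> \<not> (v j \<le> v m \<and> v m \<le> v i)" (is "?L \<longleftrightarrow> ?R")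
  proof
    assume ?L then show ?R using assms(2) by auto
  next
    assume ?R
    then consider "v m < v j" | "v i < v m" by linarith
    then show ?L
    \<comment> \<open>The cut crossed twice lies just above the level of \<open>m\<close> if that
      level is too low, and just above the level of \<open>i\<close> if it is too high.\<close>
    proof cases
      case 1 with assms show ?thesis by (intro exI[of _ "v m"]) (auto intro: less_le_trans)
    next
      case 2 with assms show ?thesis by (intro exI[of _ "v i"]) (auto intro: less_le_trans)
    qed
  qed
  then show ?thesis by (simp add: cut_coeff_def)
qed

section \<open>Decomposition of the conjugating sequence\<close>

lemma bounded_linear_transpose: "bounded_linear (transpose :: 'm::finite mtx \<Rightarrow> 'm mtx)"
  by (rule linear_conv_bounded_linear[THEN iffD1], rule linearI) (simp_all add: transpose_def vec_eq_iff)

lemma matrix_inv_left: "invertible A \<Longrightarrow> matrix_inv A ** A = mat 1"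
  unfolding invertible_def matrix_inv_def by (rule someI2_ex) auto

lemma closed_O_pq: "closed (O_pq P)"
  unfolding O_pq_def
  by (intro closed_Collect_eq mtx_mult.continuous_on bounded_linear.continuous_on[OF bounded_linear_transpose]
      continuous_on_id continuous_on_const)

text \<open>The weights are positive and distinct, so a minimiser has orthogonal columns: stationarity along the generator of
  so(p,q) in the \<open>(u, v)\<close> plane says that the scalar product of the columns \<open>u\<close> and \<open>v\<close>, multiplied by
  the nonzero number \<open>W v - sg P u * sg P v * W u\<close>, vanishes.\<close>
lemma exists_KAH_decomposition:
  fixes b :: "'m::finite mtx"
  assumes b: "invertible b"
  obtains k a h where "orthogonal_matrix k" "\<And>i. a i > 0" "h \<in> O_pq P" "b ** h = k ** diagm a"
proof -
  define W :: "'m \<Rightarrow> real" where "W i = 1 + real (to_nat i)" for i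
  have W1: "W i \<ge> 1" for i by (simp add: W_def)
  have W0: "W i \<ge> 0" for i by (simp add: W_def)
  have W_inj: "W u \<noteq> W v" if "u \<noteq> v" for u v using that by (simp add: W_def)
  define f where "f g = (\<Sum>i\<in>UNIV. \<Sum>j\<in>UNIV. W i * ((b ** g)$j$i)\<^sup>2)" for g
  \<comment> \<open>This sublevel set is compact, since invertibility of \<open>b\<close> turns a
    bound on \<open>b ** g\<close> into one on \<open>g\<close>. It contains the identity, so a
    minimiser on it is one on all of O(p,q).\<close>
  define S where "S = {g \<in> O_pq P. f g \<le> f (mat 1)}"
  have f_cont: "continuous_on A f" for A
  proof -
    have "continuous_on A (\<lambda>g. (b ** g)$j$i)" for i j
      by (rule linear_continuous_on[OF bounded_linear_compose[OF
            bounded_linear_compose[OF bounded_linear_vec_nth bounded_linear_vec_nth] mtx_mult.bounded_linear_right]])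
    then show ?thesis
      unfolding f_def by (intro continuous_on_sum continuous_on_mult continuous_on_power continuous_on_const)
  qed
  have "closed S"
    unfolding S_def Collect_conj_eq Collect_mem_eq
    by (intro closed_Int closed_O_pq closed_Collect_le f_cont continuous_on_const)
  moreover have "bounded S"
  proof -
    obtain K where K: "K > 0" "\<forall>(A :: 'm mtx) (B :: 'm mtx). norm (A ** B) \<le> norm A * norm B * K"
      using bounded_bilinear.pos_bounded[OF bounded_bilinear_mtx_mult[where 'm='m]] by auto
    define B where "B = real CARD('m) * (real CARD('m) * (1 + f (mat 1)))"
    have "norm g \<le> norm (matrix_inv b) * B * K" if "g \<in> S" for g
    proof -
      have entry: "\<bar>(b ** g)$j$i\<bar> \<le> 1 + f (mat 1)" for i j
      proof -
        have "((b ** g)$j$i)\<^sup>2 \<le> W i * ((b ** g)$j$i)\<^sup>2"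
          using mult_right_mono[OF W1[of i], of "((b ** g)$j$i)\<^sup>2"] by simp
        also have "\<dots> \<le> (\<Sum>j\<in>UNIV. W i * ((b ** g)$j$i)\<^sup>2)"
          by (rule member_le_sum) (auto simp: W0)
        also have "\<dots> \<le> f g"
          unfolding f_def
          by (rule member_le_sum[of i UNIV "\<lambda>i. \<Sum>j\<in>UNIV. W i * ((b ** g)$j$i)\<^sup>2"])
            (auto intro!: sum_nonneg simp: W0)
        also have "\<dots> \<le> f (mat 1)" using that by (simp add: S_def)
        finally have le: "((b ** g)$j$i)\<^sup>2 \<le> f (mat 1)" .
        have "0 \<le> (\<bar>(b ** g)$j$i\<bar> - 1)\<^sup>2" by simp
        then have "2 * \<bar>(b ** g)$j$i\<bar> \<le> 1 + ((b ** g)$j$i)\<^sup>2"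
          by (simp add: power2_diff)
        with le show ?thesis
          using zero_le_power2[of "(b ** g)$j$i"] by linarith
      qed
      have "norm (b ** g) \<le> (\<Sum>i\<in>(UNIV::'m set). \<Sum>j\<in>(UNIV::'m set). 1 + f (mat 1))"
        by (intro order_trans[OF norm_mtx_le] sum_mono entry)
      then have bg: "norm (b ** g) \<le> B" by (simp add: B_def)
      have "g = matrix_inv b ** (b ** g)"
        by (simp add: matrix_mul_assoc matrix_inv_left[OF b])
      then have "norm g = norm (matrix_inv b ** (b ** g))" by (rule arg_cong)
      also have "\<dots> \<le> norm (matrix_inv b) * norm (b ** g) * K" by (rule K(2)[rule_format])
      also have "\<dots> \<le> norm (matrix_inv b) * B * K"
        using bg K(1) by (intro mult_right_mono mult_left_mono) auto
      finally show ?thesis .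
    qed
    then show ?thesis by (auto simp: bounded_iff)
  qed
  ultimately have "compact S" by (simp add: compact_eq_bounded_closed)
  moreover have "mat 1 \<in> S" by (simp add: S_def O_pq_one)
  ultimately obtain h where "h \<in> S" and minS: "\<And>g. g \<in> S \<Longrightarrow> f h \<le> f g"
    using continuous_attains_inf[of S f] f_cont by blast
  then have h: "h \<in> O_pq P" by (simp add: S_def)
  have min: "f h \<le> f g" if "g \<in> O_pq P" for g
  proof (cases "f g \<le> f (mat 1)")
    case True
    then show ?thesis using that by (intro minS) (simp add: S_def)
  next
    case False
    then show ?thesis using minS[OF \<open>mat 1 \<in> S\<close>] by linarith
  qed
  define C where "C = b ** h"
  \<comment> \<open>First-order condition at the minimiser \<open>h\<close> along the curves
    \<open>h ** mexp (t *\<^sub>R X)\<close>, which stay in O(p,q).\<close>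
  have stat: "(\<Sum>i\<in>UNIV. \<Sum>j\<in>UNIV. W i * (C$j$i * (C ** X)$j$i)) = 0" if X: "X \<in> so_pq P" for X
  proof -
    have e: "f (h ** mexp (t *\<^sub>R X)) = (\<Sum>i\<in>UNIV. \<Sum>j\<in>UNIV. W i * ((C ** mexp (t *\<^sub>R X))$j$i)\<^sup>2)" for t
      by (simp add: f_def C_def matrix_mul_assoc)
    have d: "((\<lambda>t. (C ** mexp (t *\<^sub>R X))$j$i) has_real_derivative (C ** X)$j$i) (at 0)" for i j
      using bounded_linear.has_vector_derivative[OF bounded_linear_compose[OF
            bounded_linear_compose[OF bounded_linear_vec_nth bounded_linear_vec_nth] mtx_mult.bounded_linear_right[of C]]
        mexp_has_vector_derivative_0[of X]]
      by (simp add: o_def has_real_derivative_iff_has_vector_derivative)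
    have "((\<lambda>t. f (h ** mexp (t *\<^sub>R X))) has_real_derivative
        (\<Sum>i\<in>UNIV. \<Sum>j\<in>UNIV. W i * (2 * (C$j$i * (C ** X)$j$i)))) (at 0)"
      unfolding e by (rule DERIV_sum, rule DERIV_sum, rule DERIV_cmult)
        (use DERIV_power[OF d, where n=2] in \<open>simp add: mult_ac\<close>)
    moreover have "f (h ** mexp (0 *\<^sub>R X)) \<le> f (h ** mexp (t *\<^sub>R X))" for t
      using X by (simp add: min O_pq_mult h mexp_in_O_pq subspace_scale[OF so_pq_subspace])
    ultimately have "(\<Sum>i\<in>UNIV. \<Sum>j\<in>UNIV. W i * (2 * (C$j$i * (C ** X)$j$i))) = 0"
      by (intro DERIV_local_min[where d=1]) auto
    moreover have "(\<Sum>i\<in>UNIV. \<Sum>j\<in>UNIV. W i * (2 * (C$j$i * (C ** X)$j$i)))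
        = 2 * (\<Sum>i\<in>UNIV. \<Sum>j\<in>UNIV. W i * (C$j$i * (C ** X)$j$i))"
      by (simp add: sum_distrib_left mult_ac)
    ultimately show ?thesis by simp
  qed
  have gram: "(\<Sum>j\<in>UNIV. C$j$u * C$j$v) = 0" if uv: "u \<noteq> v" for u v
  proof -
    \<comment> \<open>An infinitesimal rotation if the signs at \<open>u\<close> and
      \<open>v\<close> agree, an infinitesimal boost otherwise.\<close>
    define X :: "'m mtx" where "X = (\<chi> i j. (if i = u \<and> j = v then 1 else 0) - (if i = v \<and> j = u then sg P u * sg P v else 0))"
    have "X \<in> so_pq P"
      by (rule so_pqI) (use uv in \<open>auto simp: X_def sg_def\<close>)
    have CX: "(C ** X)$j$i = (if i = v then C$j$u else 0) - (if i = u then sg P u * sg P v * C$j$v else 0)" for i j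
    proof -
      have "(C ** X)$j$i = (\<Sum>l\<in>UNIV. (if l = u then (if i = v then C$j$u else 0) else 0)
          - (if l = v then (if i = u then sg P u * sg P v * C$j$v else 0) else 0))"
        unfolding matrix_matrix_mult_def vec_lambda_beta
        by (rule sum.cong) (use uv in \<open>auto simp: X_def\<close>)
      then show ?thesis by (simp add: sum_subtractf)
    qed
    have "0 = (\<Sum>i\<in>UNIV. \<Sum>j\<in>UNIV. W i * (C$j$i * (C ** X)$j$i))"
      using stat[OF \<open>X \<in> so_pq P\<close>] by simp
    also have "\<dots> = (\<Sum>i\<in>UNIV. (if i = v then W v * (\<Sum>j\<in>UNIV. C$j$u * C$j$v) else 0)
        - (if i = u then W u * (sg P u * sg P v * (\<Sum>j\<in>UNIV. C$j$u * C$j$v)) else 0))"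
      unfolding CX using uv by (intro sum.cong refl) (auto simp: sum_distrib_left sum_negf[symmetric] mult_ac)
    also have "\<dots> = (W v - sg P u * sg P v * W u) * (\<Sum>j\<in>UNIV. C$j$u * C$j$v)"
      by (simp add: sum_subtractf algebra_simps)
    finally have "(W v - sg P u * sg P v * W u) * (\<Sum>j\<in>UNIV. C$j$u * C$j$v) = 0" by simp
    \<comment> \<open>Equal signs give \<open>W v - W u\<close>, opposite signs
      \<open>W v + W u\<close>.\<close>
    moreover have "W v - sg P u * sg P v * W u \<noteq> 0"
      using W_inj[OF uv] W1[of u] W1[of v] by (auto simp: sg_def)
    ultimately show ?thesis by simp
  qed
  \<comment> \<open>The lengths of the orthogonal columns of \<open>C\<close>; dividing by them
    produces the orthogonal factor \<open>k\<close>.\<close>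
  define a where "a i = sqrt (\<Sum>j\<in>UNIV. (C$j$i)\<^sup>2)" for i
  obtain h' where "h' ** h = mat 1" using O_pq_inverse[OF h] by blast
  then have C': "(h' ** matrix_inv b) ** C = mat 1"
    unfolding C_def using matrix_inv_left[OF b] by (metis matrix_mul_assoc matrix_mul_lid)
  have a: "a i > 0" for i
  proof -
    have "(\<Sum>j\<in>UNIV. (C$j$i)\<^sup>2) \<noteq> 0"
    proof
      assume "(\<Sum>j\<in>UNIV. (C$j$i)\<^sup>2) = 0"
      then have "C$j$i = 0" for j by (simp add: sum_nonneg_eq_0_iff)
      then have "((h' ** matrix_inv b) ** C)$i$i = 0"
        by (simp add: matrix_matrix_mult_def[of _ C])
      then show False unfolding C' by (simp add: mat_def)
    qed
    then show ?thesis by (simp add: a_def sum_nonneg less_le)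
  qed
  define k where "k = C ** diagm (\<lambda>i. inverse (a i))"
  have "transpose k ** k = mat 1"
    unfolding vec_eq_iff
  proof (intro allI)
    fix u v
    have "(transpose k ** k)$u$v = inverse (a u) * inverse (a v) * (\<Sum>j\<in>UNIV. C$j$u * C$j$v)"
    proof -
      have "k$j$i = C$j$i * inverse (a i)" for i j by (simp add: k_def)
      then show ?thesis by (simp add: matrix_matrix_mult_def transpose_def sum_distrib_left mult_ac)
    qed
    moreover have "(\<Sum>j\<in>UNIV. C$j$u * C$j$u) = a u * a u"
      by (simp add: a_def power2_eq_square sum_nonneg)
    ultimately show "(transpose k ** k)$u$v = (mat 1 :: 'm mtx)$u$v"
      using a[of u] gram[of u v] by (cases "u = v") (simp_all add: mat_def field_simps)
  qed
  moreover have "b ** h = k ** diagm a"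
    unfolding k_def using a by (simp add: C_def diagm_inverse(2) less_imp_neq[symmetric] flip: matrix_mul_assoc)
  ultimately show ?thesis using that a h by (auto simp: orthogonal_matrix)
qed

text \<open>The convergence hypothesis says that each ratio has a limit in the extended half-line
  from zero to infinity. Comparing orders of magnitude then sorts the indices into levels.\<close>

lemma ratio_levels:
  fixes a :: "nat \<Rightarrow> 'm::finite \<Rightarrow> real"
  assumes pos: "\<And>n i. a n i > 0"
    and conv: "\<And>i j. convergent (\<lambda>n. a n i / (a n i + a n j))"
  obtains v :: "'m \<Rightarrow> nat" and d :: "'m \<Rightarrow> real" where "\<forall>i. d i > 0" "\<forall>i. v i \<le> CARD('m)"
    "\<forall>i j. v i \<le> v j \<longrightarrow> (\<lambda>n. a n i / a n j) \<longlonglongrightarrow> (if v i = v j then d i / d j else 0)"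
proof -
  define small where "small i j \<longleftrightarrow> (\<lambda>n. a n i / a n j) \<longlonglongrightarrow> 0" for i j
  define near where "near i j \<longleftrightarrow> (\<exists>\<rho>>0. (\<lambda>n. a n i / a n j) \<longlonglongrightarrow> \<rho>)" for i j
  have nz: "a n i \<noteq> 0" for n i using pos[of n i] by simp
  have tri: "small i j \<or> small j i \<or> near i j" for i j
  proof -
    \<comment> \<open>The ratio transported to the unit interval: the limits 0, 1 and anything
      strictly between correspond to \<open>small i j\<close>, \<open>small j i\<close> and
      \<open>near i j\<close>.\<close>
    define x where "x n = a n i / (a n i + a n j)" for n
    have x: "a n i / a n j = x n / (1 - x n)" "a n j / a n i = (1 - x n) / x n" "0 \<le> x n" "x n \<le> 1" for n
    proof -
      have "a n i + a n j > 0" using pos[of n i] pos[of n j] by simp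
      then have "1 - x n = a n j / (a n i + a n j)" by (simp add: x_def field_simps)
      then show "a n i / a n j = x n / (1 - x n)" "a n j / a n i = (1 - x n) / x n" "0 \<le> x n" "x n \<le> 1"
        using pos[of n i] pos[of n j] by (simp_all add: x_def)
    qed
    obtain l where l: "x \<longlonglongrightarrow> l"
      using conv[of i j] unfolding convergent_def x_def by blast
    have "0 \<le> l" "l \<le> 1"
      using l x(3,4) by (auto intro: LIMSEQ_le_const LIMSEQ_le_const2)
    show ?thesis
    proof (cases "l = 1")
      case True
      have "(\<lambda>n. (1 - x n) / x n) \<longlonglongrightarrow> (1 - l) / l"
        using True by (intro tendsto_intros l) auto
      then show ?thesis using True by (simp add: small_def x)
    next
      case False
      have "(\<lambda>n. x n / (1 - x n)) \<longlonglongrightarrow> l / (1 - l)"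
        using False by (intro tendsto_intros l) auto
      then show ?thesis
        using False \<open>0 \<le> l\<close> \<open>l \<le> 1\<close>
        by (cases "l = 0") (auto simp: small_def near_def x intro!: exI[of _ "l / (1 - l)"])
    qed
  qed
  have small_mult: "small i k" if "small i j" "(\<lambda>n. a n j / a n k) \<longlonglongrightarrow> \<rho>" for i j k \<rho>
    using tendsto_mult[OF that[unfolded small_def]] by (simp add: small_def nz)
  have near_sym: "near j i" if ij: "near i j" for i j
  proof -
    obtain \<rho> where "\<rho> > 0" "(\<lambda>n. a n i / a n j) \<longlonglongrightarrow> \<rho>" using ij by (auto simp: near_def)
    from tendsto_inverse[OF this(2)] this(1) show ?thesis
      by (auto simp: near_def intro!: exI[of _ "inverse \<rho>"])
  qed
  \<comment> \<open>The level counts the indices of strictly smaller order. As \<open>small\<close>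
    is transitive and irreflexive, the level grows strictly along it.\<close>
  define v where "v i = card {k. small k i}" for i
  have v_small: "v i < v j" if "small i j" for i j
    unfolding v_def
  proof (rule psubset_card_mono)
    have "\<not> small i i" by (simp add: small_def nz LIMSEQ_const_iff)
    then show "{k. small k i} \<subset> {k. small k j}"
      using that small_mult[OF _ that[unfolded small_def]] by auto
  qed simp
  have v_near: "v i = v j" if "near i j" for i j
  proof -
    have "small k i \<longleftrightarrow> small k j" for k
      using that near_sym[OF that] small_mult unfolding near_def by blast
    then show ?thesis by (simp add: v_def)
  qed
  have level_near: "near i j" if "v i = v j" for i j
    using tri[of i j] v_small[of i j] v_small[of j i] that by auto
  have level_small: "small i j" if "v i < v j" for i j
    using tri[of i j] v_small[of j i] v_near[of i j] that by auto
  \<comment> \<open>The choice depends only on the level, so indices of equal level share a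
    representative; \<open>d\<close> measures each index against it.\<close>
  define R where "R i = (SOME j. v j = v i)" for i
  have "v (R i) = v i" for i unfolding R_def by (rule someI) (rule refl)
  then have "near i (R i)" for i by (intro level_near) simp
  then obtain d where d: "\<And>i. d i > 0" "\<And>i. (\<lambda>n. a n i / a n (R i)) \<longlonglongrightarrow> d i"
    unfolding near_def by metis
  have "(\<lambda>n. a n i / a n j) \<longlonglongrightarrow> (if v i = v j then d i / d j else 0)" if le: "v i \<le> v j" for i j
  proof (cases "v i = v j")
    case True
    then have "R i = R j" by (simp add: R_def)
    have "(\<lambda>n. (a n i / a n (R i)) / (a n j / a n (R j))) \<longlonglongrightarrow> d i / d j"
      using d(1)[of j] by (intro tendsto_divide d(2)) simp
    then show ?thesis using True by (simp add: \<open>R i = R j\<close> nz)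
  next
    case False
    with le show ?thesis using level_small[of i j] by (simp add: small_def)
  qed
  moreover have "v i \<le> CARD('m)" for i
    unfolding v_def by (rule card_mono) auto
  ultimately show ?thesis
    using d(1) by (intro that[of d v]) auto
qed

section \<open>The Lie algebra of the conjugacy limit\<close>

text \<open>Conjugation by an element of O(p,q) preserves PO(p,q), so the factor \<open>h\<close>
  disappears and only \<open>k\<close> and \<open>diagm a\<close> act.\<close>

lemma conj_set_PO_pq:
  assumes k: "orthogonal_matrix k" and a: "\<And>i. a i > 0" and h: "h \<in> O_pq P"
    and b: "invertible b" "b ** h = k ** diagm a"
  shows "conj_set b (PO_pq P)
    = {k ** (diagm a ** g ** diagm (\<lambda>i. inverse (a i))) ** transpose k | g. g \<in> PO_pq P}"
proof -
  obtain h' where h': "h' \<in> O_pq P" "h' ** h = mat 1" "h ** h' = mat 1"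
    using O_pq_inverse[OF h] by blast
  let ?d = "diagm (\<lambda>i. inverse (a i))"
  have d: "?d ** diagm a = mat 1"
    by (rule diagm_inverse(2)) (use a in \<open>simp add: less_imp_neq[symmetric]\<close>)
  have kk: "transpose k ** k = mat 1" using k by (simp add: orthogonal_matrix)
  have b_eq: "b = k ** diagm a ** h'"
    using arg_cong[OF b(2), of "\<lambda>x. x ** h'"] by (simp add: h' flip: matrix_mul_assoc)
  have "(h ** ?d ** transpose k) ** b = h ** ?d ** (transpose k ** k) ** diagm a ** h'"
    by (simp only: b_eq matrix_mul_assoc)
  also have "\<dots> = h ** (?d ** diagm a) ** h'"
    by (simp only: kk matrix_mul_rid matrix_mul_assoc)
  also have "\<dots> = mat 1" by (simp add: d h')
  finally have binv: "matrix_inv b = h ** ?d ** transpose k"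
    by (rule mtx_left_inverse_unique[OF matrix_inv_left[OF b(1)]])
  have PO: "x ** g ** y \<in> PO_pq P" if "x \<in> O_pq P" "g \<in> PO_pq P" "y \<in> O_pq P" for x g y
  proof -
    obtain c g' where "c \<noteq> 0" "g' \<in> O_pq P" "g = c *\<^sub>R g'"
      using \<open>g \<in> PO_pq P\<close> by (auto simp: PO_pq_def)
    then show ?thesis
      using O_pq_mult[OF O_pq_mult[OF that(1)] that(3), of g'] unfolding PO_pq_def
      by (auto simp: mtx_mult.scaleR_left mtx_mult.scaleR_right)
  qed
  have eq: "b ** g ** matrix_inv b = k ** (diagm a ** (h' ** g ** h) ** ?d) ** transpose k" for g
    unfolding binv by (simp add: b_eq matrix_mul_assoc)
  have inv: "h' ** (h ** g ** h') ** h = g" for g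
  proof -
    have "h' ** (h ** g ** h') ** h = (h' ** h) ** g ** (h' ** h)" by (simp only: matrix_mul_assoc)
    then show ?thesis by (simp add: h')
  qed
  show ?thesis
  proof (intro equalityI subsetI)
    fix x assume "x \<in> conj_set b (PO_pq P)"
    then obtain g where "g \<in> PO_pq P" "x = b ** g ** matrix_inv b"
      by (auto simp: conj_set_def)
    with PO[OF h'(1) _ h] eq show "x \<in> {k ** (diagm a ** g ** ?d) ** transpose k | g. g \<in> PO_pq P}"
      by blast
  next
    fix x assume "x \<in> {k ** (diagm a ** g ** ?d) ** transpose k | g. g \<in> PO_pq P}"
    then obtain g where g: "g \<in> PO_pq P" "x = k ** (diagm a ** g ** ?d) ** transpose k"
      by blast
    have "x = b ** (h ** g ** h') ** matrix_inv b"
      unfolding eq inv g(2) ..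
    with PO[OF h g(1) h'(1)] show "x \<in> conj_set b (PO_pq P)"
      unfolding conj_set_def by blast
  qed
qed

section \<open>Compactness and passage to a subsequence\<close>

lemma bounded_range_mtx:
  fixes A :: "'i \<Rightarrow> 'm::finite mtx"
  assumes "\<And>n i j. \<bar>A n $ i $ j\<bar> \<le> B"
  shows "bounded (range A)"
proof -
  have "norm (A n) \<le> (\<Sum>i\<in>(UNIV::'m set). \<Sum>j\<in>(UNIV::'m set). B)" for n
    by (intro order_trans[OF norm_mtx_le] sum_mono assms)
  then show ?thesis unfolding bounded_iff by blast
qed

lemma tendsto_mtxI:
  fixes f :: "'i \<Rightarrow> 'm::finite mtx"
  shows "(\<And>i j. ((\<lambda>x. f x $ i $ j) \<longlongrightarrow> L $ i $ j) F) \<Longrightarrow> (f \<longlongrightarrow> L) F"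
  by (intro vec_tendstoI)

lemma tendsto_entry: "(f \<longlongrightarrow> L) F \<Longrightarrow> ((\<lambda>x. f x $ i $ j) \<longlongrightarrow> L $ i $ j) F"
  by (intro tendsto_vec_nth)

lemma bounded_orthogonal: "bounded (range k)" if "\<And>n. orthogonal_matrix (k n :: 'm::finite mtx)"
proof (rule bounded_range_mtx)
  fix n i j
  have "(\<Sum>l\<in>UNIV. (k n $ l $ j)\<^sup>2) = (transpose (k n) ** k n) $ j $ j"
    by (simp add: matrix_matrix_mult_def transpose_def power2_eq_square)
  also have "\<dots> = 1" using that[of n] by (simp add: orthogonal_matrix mat_def)
  finally have "(k n $ i $ j)\<^sup>2 \<le> 1"
    using member_le_sum[of i UNIV "\<lambda>l. (k n $ l $ j)\<^sup>2"] by simp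
  then show "\<bar>k n $ i $ j\<bar> \<le> 1" by (simp add: abs_square_le_1)
qed

lemma geom_converges_liftE:
  assumes "geom_converges H L" "g \<in> L"
  obtains h c where "\<And>n. h n \<in> H n" "\<And>n. c n \<noteq> 0" "(\<lambda>n. c n *\<^sub>R h n) \<longlonglongrightarrow> g"
  using assms unfolding geom_converges_def pgl_tendsto_def by blast

lemma geom_converges_accumulation:
  assumes "geom_converges H L" "\<And>n. h n \<in> H n" "strict_mono r" "invertible g" "pgl_tendsto (h \<circ> r) g"
  shows "g \<in> L"
  using assms unfolding geom_converges_def by blast

text \<open>Orthogonal factors and normalised ratios are both bounded, so one subsequence makes the
  pair converge. The limit of the orthogonal factors is again orthogonal.\<close>

lemma KAH_subsequence:
  fixes b :: "nat \<Rightarrow> 'm::finite mtx"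
  assumes b: "\<And>n. invertible (b n)"
  obtains r :: "nat \<Rightarrow> nat" and K a k v d where "strict_mono r"
    "\<forall>n. orthogonal_matrix (K n)" "\<forall>n i. a n i > 0"
    "\<forall>n. conj_set (b (r n)) (PO_pq P)
       = {K n ** (diagm (a n) ** g ** diagm (\<lambda>i. inverse (a n i))) ** transpose (K n) | g. g \<in> PO_pq P}"
    "orthogonal_matrix k" "K \<longlonglongrightarrow> k"
    "\<forall>i. d i > 0" "\<forall>i. v i \<le> CARD('m)"
    "\<forall>i j. v i \<le> (v j :: nat) \<longrightarrow> (\<lambda>n. a n i / a n j) \<longlonglongrightarrow> (if v i = v j then d i / d j else (0::real))"
proof -
  have "\<exists>k a h. orthogonal_matrix k \<and> (\<forall>i. a i > 0) \<and> h \<in> O_pq P \<and> b n ** h = k ** diagm a" for n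
    by (rule exists_KAH_decomposition[OF b[of n], of P]) blast
  then obtain K a h where K: "\<And>n. orthogonal_matrix (K n)" and a: "\<And>n i. a n i > 0"
    and h: "\<And>n. h n \<in> O_pq P" and dec: "\<And>n. b n ** h n = K n ** diagm (a n)"
    by metis
  define \<rho> :: "nat \<Rightarrow> 'm mtx" where "\<rho> n = (\<chi> i j. a n i / (a n i + a n j))" for n
  have "bounded (range \<rho>)"
  proof (rule bounded_range_mtx)
    show "\<bar>\<rho> n $ i $ j\<bar> \<le> 1" for n i j
      using a[of n i] a[of n j] by (simp add: \<rho>_def)
  qed
  then have "bounded (range K \<times> range \<rho>)"
    by (intro bounded_Times bounded_orthogonal[of K] K)
  then have "bounded (range (\<lambda>n. (K n, \<rho> n)))"
    by (rule bounded_subset) auto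
  then obtain l r where r: "strict_mono r" and lim: "((\<lambda>n. (K n, \<rho> n)) \<circ> r) \<longlonglongrightarrow> l"
    using bounded_imp_convergent_subsequence by blast
  have Kl: "(\<lambda>n. K (r n)) \<longlonglongrightarrow> fst l" and \<rho>l: "(\<lambda>n. \<rho> (r n)) \<longlonglongrightarrow> snd l"
    using tendsto_fst[OF lim] tendsto_snd[OF lim] by (simp_all add: o_def)
  have conv: "convergent (\<lambda>n. a (r n) i / (a (r n) i + a (r n) j))" for i j
    using tendsto_entry[OF \<rho>l, of i j] by (auto simp: convergent_def \<rho>_def)
  obtain d v where vd: "\<forall>i. d i > 0" "\<forall>i. v i \<le> CARD('m)"
    "\<forall>i j. v i \<le> (v j :: nat) \<longrightarrow> (\<lambda>n. a (r n) i / a (r n) j) \<longlonglongrightarrow> (if v i = v j then d i / d j else 0)"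
    by (rule ratio_levels[of "\<lambda>n. a (r n)", OF a conv]) (rule that)
  have "(\<lambda>n. transpose (K (r n)) ** K (r n)) \<longlonglongrightarrow> transpose (fst l) ** fst l"
    by (intro mtx_mult.tendsto bounded_linear.tendsto[OF bounded_linear_transpose] Kl)
  moreover have "(\<lambda>n. transpose (K (r n)) ** K (r n)) = (\<lambda>n. mat 1)"
    using K by (simp add: orthogonal_matrix)
  ultimately have "orthogonal_matrix (fst l)"
    by (simp add: orthogonal_matrix LIMSEQ_const_iff)
  moreover have "\<forall>n. conj_set (b (r n)) (PO_pq P)
      = {K (r n) ** (diagm (a (r n)) ** g ** diagm (\<lambda>i. inverse (a (r n) i))) ** transpose (K (r n)) | g. g \<in> PO_pq P}"
    by (intro allI conj_set_PO_pq[OF K a h b dec])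
  ultimately show ?thesis
    using K a by (intro that[of r "\<lambda>n. K (r n)" "\<lambda>n. a (r n)", OF r _ _ _ _ Kl vd]) simp_all
qed

text \<open>The entries of an inverse in the conjugated group are, up to one common factor, multiples of the transposed entries
  by squared ratios, which survive in the limit whenever the ratio stays bounded.\<close>
lemma lie_limit_entries:
  fixes K :: "nat \<Rightarrow> 'm::finite mtx"
  assumes geom: "geom_converges H L" and r: "strict_mono r"
    and H: "\<And>n. H (r n)
       = {K n ** (diagm (a n) ** g ** diagm (\<lambda>i. inverse (a n i))) ** transpose (K n) | g. g \<in> PO_pq P}"
    and K: "\<And>n. orthogonal_matrix (K n)" and a: "\<And>n i. a n i > 0"
    and k: "orthogonal_matrix k" "K \<longlonglongrightarrow> k"
    and X: "X \<in> lie_pgl L" and lim: "(\<lambda>n. a n i / a n j) \<longlonglongrightarrow> \<tau> i j"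
    and refl: "\<And>i. \<tau> i i = 1"
  shows "(transpose k ** X ** k) $ i $ j = - (sg P i * sg P j * (\<tau> i j)\<^sup>2 * (transpose k ** X ** k) $ j $ i)"
proof -
  define Y where "Y = transpose k ** X ** k"
  have kk: "transpose k ** k = mat 1" "k ** transpose k = mat 1" using k(1) by (simp_all add: orthogonal_matrix_def)
  have KK: "transpose (K n) ** K n = mat 1" for n using K by (simp add: orthogonal_matrix)
  have nz: "a n i \<noteq> 0" for n i using a[of n i] by simp
  have "trace Y = trace (k ** transpose k ** X)"
    unfolding Y_def by (subst trace_mul_sym) (simp add: matrix_mul_assoc)
  also have "\<dots> = 0" using X by (simp add: kk lie_pgl_def)
  finally have tr: "trace Y = 0" .
  have rel: "mexp (t *\<^sub>R (- Y))$i$j * mexp (t *\<^sub>R Y)$l$l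
      = sg P i * sg P j * (\<tau> i j)\<^sup>2 * mexp (t *\<^sub>R Y)$j$i * mexp (t *\<^sub>R (- Y))$l$l"
    if lim: "(\<lambda>n. a n i / a n j) \<longlonglongrightarrow> \<tau> i j" for t i j l
  proof -
    have "mexp (t *\<^sub>R X) \<in> L" using X by (simp add: lie_pgl_def)
    from geom_converges_liftE[OF geom this]
    obtain h c where h: "\<And>n. h n \<in> H n" and c: "\<And>n. c n \<noteq> (0::real)"
      and hc: "(\<lambda>n. c n *\<^sub>R h n) \<longlonglongrightarrow> mexp (t *\<^sub>R X)"
      by metis
    have "\<exists>g. g \<in> PO_pq P \<and> h (r n) = K n ** (diagm (a n) ** g ** diagm (\<lambda>i. inverse (a n i))) ** transpose (K n)" for n
      using h[of "r n"] unfolding H by blast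
    then obtain g where g: "\<And>n. g n \<in> PO_pq P"
      and hg: "\<And>n. h (r n) = K n ** (diagm (a n) ** g n ** diagm (\<lambda>i. inverse (a n i))) ** transpose (K n)"
      by metis
    \<comment> \<open>The scalars realising convergence in PGL are absorbed into the group elements,
      which remain in the scalar-closed set \<open>PO_pq P\<close>.\<close>
    define p where "p n = c (r n) *\<^sub>R g n" for n
    have p: "p n \<in> PO_pq P" for n
    proof -
      obtain c' g' where "c' \<noteq> 0" "g' \<in> O_pq P" "g n = c' *\<^sub>R g'"
        using g[of n] by (auto simp: PO_pq_def)
      then show ?thesis
        unfolding PO_pq_def p_def using c[of "r n"]
        by (intro CollectI exI[of _ "c (r n) * c'"] exI[of _ g']) simp
    qed
    have "\<exists>p'. p' ** p n = mat 1" for n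
    proof -
      obtain c' g' where c': "c' \<noteq> 0" and g': "g' \<in> O_pq P" and "p n = c' *\<^sub>R g'"
        using p[of n] by (auto simp: PO_pq_def)
      then have "((1/c') *\<^sub>R (form_mat P ** transpose g' ** form_mat P)) ** p n = mat 1"
        using O_pq_left_inverse[OF g'] by (simp add: mtx_mult.scaleR_left mtx_mult.scaleR_right)
      then show ?thesis ..
    qed
    then obtain p' where p': "\<And>n. p' n ** p n = mat 1" by metis
    define G where "G n = diagm (a n) ** p n ** diagm (\<lambda>i. inverse (a n i))" for n
    define I where "I n = diagm (a n) ** p' n ** diagm (\<lambda>i. inverse (a n i))" for n
    have IG: "I n ** G n = mat 1" for n
    proof -
      have "I n ** G n = diagm (a n) ** p' n ** (diagm (\<lambda>i. inverse (a n i)) ** diagm (a n)) ** p n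
          ** diagm (\<lambda>i. inverse (a n i))"
        by (simp only: I_def G_def matrix_mul_assoc)
      also have "\<dots> = diagm (a n) ** (p' n ** p n) ** diagm (\<lambda>i. inverse (a n i))"
        by (simp only: diagm_inverse(2)[of "a n", OF nz] matrix_mul_rid matrix_mul_assoc)
      also have "\<dots> = mat 1"
        by (simp add: p' diagm_inverse(1)[of "a n", OF nz])
      finally show ?thesis .
    qed
    have "c (r n) *\<^sub>R h (r n) = K n ** G n ** transpose (K n)" for n
      by (simp add: hg G_def p_def mtx_mult.scaleR_left mtx_mult.scaleR_right)
    then have "transpose (K n) ** (c (r n) *\<^sub>R h (r n)) ** K n
        = (transpose (K n) ** K n) ** G n ** (transpose (K n) ** K n)" for n
      by (simp only: matrix_mul_assoc)
    then have G_eq: "G n = transpose (K n) ** (c (r n) *\<^sub>R h (r n)) ** K n" for n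
      by (simp add: KK)
    have "(\<lambda>n. c (r n) *\<^sub>R h (r n)) \<longlonglongrightarrow> mexp (t *\<^sub>R X)"
      using LIMSEQ_subseq_LIMSEQ[OF hc r] by (simp add: o_def)
    then have "G \<longlonglongrightarrow> transpose k ** mexp (t *\<^sub>R X) ** k"
      unfolding G_eq[abs_def] by (intro mtx_mult.tendsto bounded_linear.tendsto[OF bounded_linear_transpose] k)
    also have "transpose k ** mexp (t *\<^sub>R X) ** k = mexp (t *\<^sub>R Y)"
      unfolding Y_def using mexp_conj[OF kk(2), of "t *\<^sub>R X"]
      by (simp add: mtx_mult.scaleR_left mtx_mult.scaleR_right)
    finally have Gl: "G \<longlonglongrightarrow> mexp (t *\<^sub>R Y)" .
    have Il: "I \<longlonglongrightarrow> mexp (t *\<^sub>R (- Y))"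
      by (rule tendsto_mtx_inverse[OF Gl IG]) (simp add: mexp_minus_mult)
    \<comment> \<open>Conjugation by \<open>diagm (a n)\<close> multiplies the entry at
      \<open>(i, j)\<close> by the ratio and the entry at \<open>(j, i)\<close> by its reciprocal,
      whence the square; diagonal entries are unchanged.\<close>
    have eq: "I n $ i $ j * G n $ l $ l = sg P i * sg P j * (a n i / a n j)\<^sup>2 * G n $ j $ i * I n $ l $ l" for n
    proof -
      have "I n $ i $ j * G n $ l $ l = (a n i / a n j) * (p' n $ i $ j * p n $ l $ l)"
        using nz[of n] by (simp add: I_def G_def divide_inverse mult_ac)
      also have "\<dots> = (a n i / a n j) * (sg P i * sg P j * p n $ j $ i * p' n $ l $ l)"
        using PO_pq_inverse_entries[OF p p'] by simp
      also have "\<dots> = sg P i * sg P j * (a n i / a n j)\<^sup>2 * G n $ j $ i * I n $ l $ l"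
        using nz[of n] by (simp add: I_def G_def field_simps power2_eq_square)
      finally show ?thesis .
    qed
    have "(\<lambda>n. I n $ i $ j * G n $ l $ l) \<longlonglongrightarrow> mexp (t *\<^sub>R (- Y))$i$j * mexp (t *\<^sub>R Y)$l$l"
      by (intro tendsto_mult tendsto_entry Gl Il)
    moreover have "(\<lambda>n. I n $ i $ j * G n $ l $ l)
        \<longlonglongrightarrow> sg P i * sg P j * (\<tau> i j)\<^sup>2 * mexp (t *\<^sub>R Y)$j$i * mexp (t *\<^sub>R (- Y))$l$l"
      unfolding eq by (intro tendsto_mult tendsto_entry Gl Il tendsto_power lim tendsto_const)
    ultimately show ?thesis by (rule LIMSEQ_unique)
  qed
  have "Y $ i $ j = - ((sg P i * sg P j * (\<tau> i j)\<^sup>2) * Y $ j $ i)"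
  proof (rule mexp_entries_tangent[where R = "\<lambda>i j. (\<lambda>n. a n i / a n j) \<longlonglongrightarrow> \<tau> i j"
        and \<rho> = "\<lambda>i j. sg P i * sg P j * (\<tau> i j)\<^sup>2"])
    show "trace Y = 0" by (rule tr)
    show "(\<lambda>n. a n i / a n i) \<longlonglongrightarrow> \<tau> i i" for i by (simp add: nz refl)
    show "sg P i * sg P i * (\<tau> i i)\<^sup>2 = 1" for i by (simp add: refl)
    show "(\<lambda>n. a n i / a n j) \<longlonglongrightarrow> \<tau> i j" by (rule lim)
  qed (rule rel)
  then show ?thesis by (simp add: Y_def)
qed

text \<open>The conjugated one-parameter groups of \<open>Z n\<close> lie in the groups of the
  sequence and converge to that of \<open>k ** Y ** transpose k\<close>. Letting \<open>Z n\<close>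
  vary with \<open>n\<close> compensates for entries that conjugation would make unbounded.\<close>

lemma lie_limitI:
  fixes K :: "nat \<Rightarrow> 'm::finite mtx"
  assumes geom: "geom_converges H L" and r: "strict_mono r"
    and H: "\<And>n. H (r n)
       = {K n ** (diagm (a n) ** g ** diagm (\<lambda>i. inverse (a n i))) ** transpose (K n) | g. g \<in> PO_pq P}"
    and H1: "\<And>n. mat 1 \<in> H n"
    and K: "\<And>n. orthogonal_matrix (K n)" and a: "\<And>n i. a n i > 0"
    and k: "orthogonal_matrix k" "K \<longlonglongrightarrow> k"
    and Z: "\<And>n. Z n \<in> so_pq P"
    and Y: "(\<lambda>n. diagm (a n) ** Z n ** diagm (\<lambda>i. inverse (a n i))) \<longlonglongrightarrow> Y"
  shows "k ** Y ** transpose k \<in> lie_pgl L"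
proof -
  let ?d = "\<lambda>n. diagm (\<lambda>i. inverse (a n i))"
  have nz: "a n i \<noteq> 0" for n i using a[of n i] by simp
  have kk: "transpose k ** k = mat 1" using k(1) by (simp_all add: orthogonal_matrix_def)
  have KK: "transpose (K n) ** K n = mat 1" for n using K by (simp add: orthogonal_matrix)
  have "Y $ i $ i = 0" for i
  proof (rule LIMSEQ_unique)
    show "(\<lambda>n. (diagm (a n) ** Z n ** ?d n) $ i $ i) \<longlonglongrightarrow> Y $ i $ i"
      by (rule tendsto_entry[OF Y])
    show "(\<lambda>n. (diagm (a n) ** Z n ** ?d n) $ i $ i) \<longlonglongrightarrow> 0"
      using so_pq_diag[OF Z] by simp
  qed
  then have "trace Y = 0" by (simp add: trace_def)
  moreover have "trace (k ** Y ** transpose k) = trace (transpose k ** k ** Y)"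
    by (subst trace_mul_sym) (simp add: matrix_mul_assoc)
  ultimately have tr: "trace (k ** Y ** transpose k) = 0" by (simp add: kk)
  have "mexp (t *\<^sub>R (k ** Y ** transpose k)) \<in> L" for t
  proof -
    define e where "e n = K n ** (diagm (a n) ** mexp (t *\<^sub>R Z n) ** ?d n) ** transpose (K n)" for n
    have "mexp (t *\<^sub>R Z n) \<in> PO_pq P" for n
      by (intro O_pq_imp_PO_pq mexp_in_O_pq subspace_scale[OF so_pq_subspace] Z)
    then have eH: "e n \<in> H (r n)" for n unfolding H e_def by blast
    have e_eq: "e n = mexp (t *\<^sub>R (K n ** (diagm (a n) ** Z n ** ?d n) ** transpose (K n)))" for n
    proof -
      have "e n = K n ** mexp (diagm (a n) ** (t *\<^sub>R Z n) ** ?d n) ** transpose (K n)"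
        unfolding e_def by (subst mexp_conj[of "?d n" "diagm (a n)"]) (simp_all add: diagm_inverse(2)[of "a n", OF nz])
      also have "\<dots> = mexp (K n ** (diagm (a n) ** (t *\<^sub>R Z n) ** ?d n) ** transpose (K n))"
        by (rule mexp_conj[OF KK, symmetric])
      finally show ?thesis by (simp add: mtx_mult.scaleR_left mtx_mult.scaleR_right)
    qed
    have lim: "e \<longlonglongrightarrow> mexp (t *\<^sub>R (k ** Y ** transpose k))"
      unfolding e_eq[abs_def]
      by (intro tendsto_mexp tendsto_scaleR tendsto_const mtx_mult.tendsto
          bounded_linear.tendsto[OF bounded_linear_transpose] k Y)
    \<comment> \<open>An accumulation point is taken along a full sequence, so \<open>e\<close> is
      extended by the identity outside the range of \<open>r\<close>.\<close>
    define h where "h n = (if n \<in> range r then e (inv r n) else mat 1)" for n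
    have "inj r" using r by (rule strict_mono_imp_inj_on)
    then have hr: "h \<circ> r = e" by (simp add: fun_eq_iff h_def)
    have "h n \<in> H n" for n
      using eH \<open>inj r\<close> H1 by (auto simp: h_def)
    moreover have "pgl_tendsto (h \<circ> r) (mexp (t *\<^sub>R (k ** Y ** transpose k)))"
      unfolding hr pgl_tendsto_def by (intro exI[of _ "\<lambda>_. 1"]) (simp add: lim)
    moreover have "invertible (mexp (t *\<^sub>R (k ** Y ** transpose k)))"
      using mexp_minus_mult invertible_left_inverse by blast
    ultimately show ?thesis
      using geom_converges_accumulation[OF geom _ r] by blast
  qed
  with tr show ?thesis by (simp add: lie_pgl_def)
qed

text \<open>An element of so(p,q) is determined by its block lower triangle. The isomorphism keeps
  that triangle, rescales it by \<open>d\<close> and rotates by \<open>k\<close>;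
  \<open>lower\<close> gives surjectivity and \<open>cut_coeff_between\<close> compatibility with
  brackets.\<close>

lemma lie_iso_limit:
  fixes k :: "'m::finite mtx" and v :: "'m \<Rightarrow> nat" and d :: "'m \<Rightarrow> real"
  assumes k: "orthogonal_matrix k" and d: "\<And>i. d i > 0" and v: "\<And>i. v i \<le> s"
    and lower: "\<And>X i j. X \<in> L \<Longrightarrow> v i \<le> v j \<Longrightarrow>
      (transpose k ** X ** k) $ i $ j
        = - (sg P i * sg P j * (if v i = v j then d i / d j else 0)\<^sup>2 * (transpose k ** X ** k) $ j $ i)"
    and upper: "\<And>X. X \<in> so_pq P \<Longrightarrow>
      k ** (\<chi> i j. if v j \<le> v i then d i / d j * X$i$j else 0) ** transpose k \<in> L"
  shows "lie_iso (so_pq P) (weighted_bracket (cut_coeff v s)) L commutator"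
proof -
  define f :: "'m mtx \<Rightarrow> 'm mtx" where "f X = (\<chi> i j. if v j \<le> v i then d i / d j * X$i$j else 0)" for X
  define F where "F X = k ** f X ** transpose k" for X
  have kk: "transpose k ** k = mat 1" "k ** transpose k = mat 1"
    using k by (simp_all add: orthogonal_matrix_def)
  have dn: "d i \<noteq> 0" for i using d[of i] by simp
  have unF: "transpose k ** F X ** k = f X" for X
  proof -
    have "transpose k ** F X ** k = (transpose k ** k) ** f X ** (transpose k ** k)"
      by (simp only: F_def matrix_mul_assoc)
    then show ?thesis by (simp add: kk)
  qed
  have reF: "k ** (transpose k ** X ** k) ** transpose k = X" for X
  proof -
    have "k ** (transpose k ** X ** k) ** transpose k = (k ** transpose k) ** X ** (k ** transpose k)"
      by (simp only: matrix_mul_assoc)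
    then show ?thesis by (simp add: kk)
  qed
  have "inj_on F (so_pq P)"
  proof (rule inj_onI)
    fix X Y assume X: "X \<in> so_pq P" and Y: "Y \<in> so_pq P" and "F X = F Y"
    then have "f X = f Y" by (metis unF)
    then have "f X $ i $ j = f Y $ i $ j" for i j by simp
    then have low: "X$i$j = Y$i$j" if "v j \<le> v i" for i j
      using that dn unfolding f_def by (force split: if_splits)
    have "X$i$j = Y$i$j" for i j
    proof (cases "v j \<le> v i")
      case False
      then show ?thesis
        using so_pqD[OF X, of i j] so_pqD[OF Y, of i j] low[of i j] low[of j i] by simp
    qed (rule low)
    then show "X = Y" by (simp add: vec_eq_iff)
  qed
  moreover have "F ` so_pq P = L"
  proof (intro equalityI subsetI)
    show "x \<in> L" if "x \<in> F ` so_pq P" for x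
      using that upper by (auto simp: F_def f_def)
    fix x assume x: "x \<in> L"
    define Y where "Y = transpose k ** x ** k"
    have Y: "Y$i$j = - (sg P i * sg P j * (if v i = v j then d i / d j else 0)\<^sup>2 * Y$j$i)" if "v i \<le> v j" for i j
      using lower[OF x that] by (simp add: Y_def)
    \<comment> \<open>The preimage undoes the rescaling on the lower triangle and fills the upper
      one by the symmetry of so(p,q).\<close>
    define X where "X = (\<chi> i j. if v j \<le> v i then d j / d i * Y$i$j else - (sg P i * sg P j * (d i / d j * Y$j$i)))"
    have "X \<in> so_pq P"
    proof (rule so_pqI)
      fix i j
      consider "v i = v j" | "v i < v j" | "v j < v i" by linarith
      then show "X$i$j = - (sg P i * sg P j * X$j$i)"
      proof cases
        case 1
        then have "X$i$j = d j / d i * Y$i$j" "X$j$i = d i / d j * Y$j$i"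
          by (simp_all add: X_def)
        moreover have "Y$i$j = - (sg P i * sg P j * (d i / d j)\<^sup>2 * Y$j$i)"
          using Y[of i j] 1 by simp
        ultimately show ?thesis using dn by (simp add: power2_eq_square)
      qed (simp_all add: X_def mult_ac sg_def)
    qed
    moreover have "F X = x"
    proof -
      have "f X $ i $ j = Y $ i $ j" for i j
      proof (cases "v j \<le> v i")
        case True
        then show ?thesis using dn by (simp add: f_def X_def)
      next
        case False
        then show ?thesis using Y[of i j] by (simp add: f_def)
      qed
      then have "f X = Y" by (simp add: vec_eq_iff)
      then show ?thesis by (simp add: F_def Y_def reF)
    qed
    ultimately show "x \<in> F ` so_pq P" by blast
  qed
  ultimately have bij: "bij_betw F (so_pq P) L" by (simp add: bij_betw_def)
  have "F (X + Y) = F X + F Y" for X Y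
  proof -
    have "f (X + Y) = f X + f Y" by (simp add: f_def vec_eq_iff algebra_simps)
    then show ?thesis by (simp add: F_def mtx_mult.add_left mtx_mult.add_right)
  qed
  moreover have "F (c *\<^sub>R X) = c *\<^sub>R F X" for c X
  proof -
    have "f (c *\<^sub>R X) = c *\<^sub>R f X" by (simp add: f_def vec_eq_iff)
    then show ?thesis by (simp add: F_def mtx_mult.scaleR_left mtx_mult.scaleR_right)
  qed
  moreover have "F (weighted_bracket (cut_coeff v s) X Y) = commutator (F X) (F Y)" for X Y
  proof -
    have FF: "F A ** F B = k ** (f A ** f B) ** transpose k" for A B
    proof -
      have "F A ** F B = k ** f A ** (transpose k ** k) ** f B ** transpose k"
        by (simp only: F_def matrix_mul_assoc)
      then show ?thesis by (simp add: kk matrix_mul_assoc)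
    qed
    \<comment> \<open>For \<open>v j \<le> v i\<close> the ratios telescope through
      \<open>m\<close>. Otherwise no level of \<open>m\<close> lies in the required order, and both
      sides vanish.\<close>
    have summand: "(if v j \<le> v i then d i / d j * (cut_coeff v s i m j * (X$i$m * Y$m$j - Y$i$m * X$m$j)) else 0)
        = f X$i$m * f Y$m$j - f Y$i$m * f X$m$j" for i j m
    proof (cases "v j \<le> v i")
      case True
      then show ?thesis
        using dn by (auto simp: cut_coeff_between[OF v True] f_def algebra_simps)
    qed (auto simp: f_def)
    have "f (weighted_bracket (cut_coeff v s) X Y) $ i $ j = commutator (f X) (f Y) $ i $ j" for i j
    proof -
      have "f (weighted_bracket (cut_coeff v s) X Y) $ i $ j
          = (\<Sum>m\<in>UNIV. if v j \<le> v i then d i / d j * (cut_coeff v s i m j * (X$i$m * Y$m$j - Y$i$m * X$m$j)) else 0)"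
        by (simp add: f_def weighted_bracket_def sum_distrib_left)
      also have "\<dots> = commutator (f X) (f Y) $ i $ j"
        unfolding summand by (simp add: commutator_def matrix_matrix_mult_def sum_subtractf)
      finally show ?thesis .
    qed
    then have "f (weighted_bracket (cut_coeff v s) X Y) = commutator (f X) (f Y)" by (simp add: vec_eq_iff)
    then show ?thesis
      by (simp add: F_def[of "weighted_bracket _ _ _"] commutator_def FF mtx_mult.diff_left mtx_mult.diff_right)
  qed
  ultimately show ?thesis unfolding lie_iso_def using bij by blast
qed

theorem theorem2p6:
  fixes p q :: nat and P :: "'m::finite set"
    and b :: "nat \<Rightarrow> real^'m^'m" and O' :: "(real^'m^'m) set"
  assumes "p + q = CARD('m)" and "card P = p"
    and "\<forall>n. invertible (b n)"
    and "pgl_set O'"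
    and "geom_converges (\<lambda>n. conj_set (b n) (PO_pq P)) O'"
  shows "\<exists>(s::nat) (B :: nat \<Rightarrow> real^'m^'m \<Rightarrow> real^'m^'m \<Rightarrow> real^'m^'m).
           B 0 = commutator \<and>
           (\<forall>l<s. \<exists>T Tc. is_contraction (lie_pgl (PO_pq P)) (B l) T Tc (B (Suc l))) \<and>
           lie_iso (lie_pgl (PO_pq P)) (B s) (lie_pgl O') commutator"
proof -
  have b: "invertible (b n)" for n using assms(3) by blast
  obtain r :: "nat \<Rightarrow> nat" and K a k d v where r: "strict_mono r"
    and K: "\<forall>n. orthogonal_matrix (K n)" and a: "\<forall>n i. a n i > 0"
    and H: "\<forall>n. conj_set (b (r n)) (PO_pq P)
       = {K n ** (diagm (a n) ** g ** diagm (\<lambda>i. inverse (a n i))) ** transpose (K n) | g. g \<in> PO_pq P}"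
    and k: "orthogonal_matrix k" "K \<longlonglongrightarrow> k"
    and d: "\<forall>i. d i > 0" and v: "\<forall>i. v i \<le> CARD('m)"
    and lim: "\<forall>i j. v i \<le> (v j :: nat) \<longrightarrow> (\<lambda>n. a n i / a n j) \<longlonglongrightarrow> (if v i = v j then d i / d j else (0::real))"
    by (rule KAH_subsequence[of b P, OF b]) (rule that)
  note K = K[rule_format] and a = a[rule_format] and H = H[rule_format] and d = d[rule_format]
    and v = v[rule_format] and lim = lim[rule_format]
  have nz: "a n i \<noteq> 0" "d i \<noteq> 0" for n i using a[of n i] d[of i] by simp_all
  have one: "mat 1 \<in> conj_set (b n) (PO_pq P)" for n
  proof -
    have "b n ** mat 1 ** matrix_inv (b n) = mat 1"
      using matrix_inv_left[OF b[of n]] by (simp add: matrix_left_right_inverse)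
    then show ?thesis
      unfolding conj_set_def using O_pq_imp_PO_pq[OF O_pq_one] by (metis (mono_tags, lifting) mem_Collect_eq)
  qed
  have iso: "lie_iso (so_pq P) (weighted_bracket (cut_coeff v CARD('m))) (lie_pgl O') commutator"
  proof (rule lie_iso_limit[OF k(1) d v])
    fix X i j assume "X \<in> lie_pgl O'" "v i \<le> v j"
    show "(transpose k ** X ** k) $ i $ j
        = - (sg P i * sg P j * (if v i = v j then d i / d j else 0)\<^sup>2 * (transpose k ** X ** k) $ j $ i)"
      by (rule lie_limit_entries[where \<tau> = "\<lambda>i j. if v i = v j then d i / d j else 0", OF assms(5) r H K a k \<open>X \<in> lie_pgl O'\<close> lim[OF \<open>v i \<le> v j\<close>]])
        (simp add: nz)
  next
    fix X assume X: "X \<in> so_pq P"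
    \<comment> \<open>The weight below the diagonal blocks makes the conjugated entry exactly
      \<open>d i / d j\<close> times the original. Repeating it symmetrically above keeps
      \<open>Z n\<close> in so(p,q), and there the conjugated entries tend to zero.\<close>
    define w where "w n i j = (if v i = v j then 1 else if v j < v i then a n j / a n i * (d i / d j)
        else a n i / a n j * (d j / d i))" for n i j
    define Z :: "nat \<Rightarrow> 'm mtx" where "Z n = (\<chi> i j. w n i j * X$i$j)" for n
    have w_sym: "w n i j = w n j i" for n i j by (simp add: w_def)
    have "Z n \<in> so_pq P" for n
    proof (rule so_pqI)
      show "Z n $ i $ j = - (sg P i * sg P j * Z n $ j $ i)" for i j
        using so_pqD[OF X, of i j] w_sym[of n i j] by (simp add: Z_def)
    qed
    moreover have "(\<lambda>n. diagm (a n) ** Z n ** diagm (\<lambda>i. inverse (a n i)))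
        \<longlonglongrightarrow> (\<chi> i j. if v j \<le> v i then d i / d j * X$i$j else 0)"
    proof (rule tendsto_mtxI)
      fix i j
      have "(\<lambda>n. a n i / a n j * w n i j) \<longlonglongrightarrow> (if v j \<le> v i then d i / d j else 0)"
      proof -
        consider "v i = v j" | "v j < v i" | "v i < v j" by linarith
        then show ?thesis
        proof cases
          case 1
          then show ?thesis using lim[of i j] by (simp add: w_def)
        next
          case 2
          then have "(\<lambda>n. a n i / a n j * w n i j) = (\<lambda>n. d i / d j)"
            by (auto simp: w_def nz fun_eq_iff)
          then show ?thesis using 2 by simp
        next
          case 3
          then have "(\<lambda>n. a n i / a n j) \<longlonglongrightarrow> 0" using lim[of i j] by simp
          then have "(\<lambda>n. a n i / a n j * (a n i / a n j * (d j / d i))) \<longlonglongrightarrow> 0 * (0 * (d j / d i))"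
            by (intro tendsto_mult tendsto_const)
          then show ?thesis using 3 by (simp add: w_def)
        qed
      qed
      then have "(\<lambda>n. a n i / a n j * w n i j * X$i$j) \<longlonglongrightarrow> (if v j \<le> v i then d i / d j else 0) * X$i$j"
        by (intro tendsto_mult tendsto_const)
      moreover have "(\<lambda>n. (diagm (a n) ** Z n ** diagm (\<lambda>i. inverse (a n i))) $ i $ j)
          = (\<lambda>n. a n i / a n j * w n i j * X$i$j)"
        by (simp add: Z_def divide_inverse mult_ac)
      ultimately show "(\<lambda>n. (diagm (a n) ** Z n ** diagm (\<lambda>i. inverse (a n i))) $ i $ j)
          \<longlonglongrightarrow> (\<chi> i j. if v j \<le> v i then d i / d j * X$i$j else 0) $ i $ j"
        by (simp add: if_distrib[of "\<lambda>x. x * _"] cong: if_cong)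
    qed
    ultimately show "k ** (\<chi> i j. if v j \<le> v i then d i / d j * X$i$j else 0) ** transpose k \<in> lie_pgl O'"
      by (rule lie_limitI[OF assms(5) r H one K a k])
  qed
  show ?thesis
  \<comment> \<open>No level exceeds \<open>CARD('m)\<close>, so this many cuts separate all levels.
    A cut with every index on one side contracts along the whole algebra and leaves the bracket
    unchanged.\<close>
  proof (intro exI[of _ "CARD('m)"] exI[of _ "\<lambda>l. weighted_bracket (cut_coeff v l)"] conjI allI impI)
    show "weighted_bracket (cut_coeff v 0) = commutator"
      by (simp add: cut_coeff_def[abs_def] weighted_bracket_one)
    show "\<exists>T Tc. is_contraction (lie_pgl (PO_pq P)) (weighted_bracket (cut_coeff v l)) T Tc (weighted_bracket (cut_coeff v (Suc l)))" for l
      unfolding lie_pgl_PO_pq by (rule is_contraction_cut_coeff)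
    show "lie_iso (lie_pgl (PO_pq P)) (weighted_bracket (cut_coeff v CARD('m))) (lie_pgl O') commutator"
      unfolding lie_pgl_PO_pq by (rule iso)
  qed
qed

end
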